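(* For all $n\ge 1$: $\widehat{wg}(n,1,1)=n-1$; $\widehat{wg}(n,2,1)=0$ if $n\le 2$ and $\widehat{wg}(n,2,1)=n^2-6n+9$ if $n\ge 3$; $\widehat{wg}(n,t,1)=0$ if $t\ge 3$; $wg(n,1,1)=n$; $wg(n,2,1)=n-1$ if $n\le 2$ and $wg(n,2,1)=2(n-2)^2+2$ if $n\ge 3$; $wg(n,3,1)=0$ if $n\le 3$ and $wg(n,3,1)=\frac{5n^3-48n^2+157n-174}{6}$ if $n\ge 4$; $wg(n,4,1)=0$ if $n\le 5$ and $wg(n,4,1)=\frac{n^4-16n^3+95n^2-248n+240}{12}$ if $n\ge 6$; $wg(n,t,1)=0$ if $t\ge 5$.
   Context: A simple game on $N=\{1,\dots,n\}$ is a family $\mathcal W$ of subsets of $N$ (winning coalitions) with $\emptyset\notin\mathcal W$, $N\in\mathcal W$, and upward closed. It is weighted if there are reals $w_1,\dots,w_n\ge0$, $q>0$ with $S\in\mathcal W$ iff $\sum_{i\in S}w_i\ge q$. Games are counted up to isomorphism (bijections of players preserving winning coalitions). Desirability: $i\succsim j$ iff for every $S\subseteq N\setminus\{i,j\}$, $S\cup\{j\}\in\mathcal W$ implies $S\cup\{i\}\in\mathcal W$; in a weighted game this is total, and its equivalence classes $N_1,\dots,N_t$ (with $n_h=|N_h|$) are ordered by strictly decreasing desirability. A vector $(m_1,\dots,m_t)$, $0\le m_h\le n_h$, is winning/losing according to whether coalitions with exactly $m_h$ players from each $N_h$ are winning/losing. Write $\tilde a\succeq\tilde b$ iff $\sum_{i\le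 k}a_i\ge\sum_{i\le k}b_i$ for all $k$, and $\tilde a\succ\tilde b$ if also $\tilde a\neq\tilde b$. A shift-minimal winning vector is a winning vector $\tilde m$ such that every $\tilde m'$ with $\tilde m\succ\tilde m'$ is losing. A veto player belongs to every winning coalition; a null player belongs to no minimal winning coalition; a game is non-trivial if it has no veto and no null players. $wg(n,t,r)$ is the number of weighted games with $n$ players, $t$ equivalence classes and $r$ shift-minimal winning vectors, and $\widehat{wg}(n,t,r)$ the number of those which are non-trivial. *)

theory Defs
  imports Complex_Main
begin

definition simple_game :: "'a set \<Rightarrow> 'a set set \<Rightarrow> bool" where
  "simple_game N W \<longleftrightarrow>
     W \<subseteq> Pow N \<and> {} \<notin> W \<and> N \<in> W \<and>
     (\<forall>S T. S \<in> W \<and> S \<subseteq> T \<and> T \<subseteq> N \<longrightarrow> T \<in> W)"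

definition weighted_game :: "'a set \<Rightarrow> 'a set set \<Rightarrow> bool" where
  "weighted_game N W \<longleftrightarrow>
     simple_game N W \<and>
     (\<exists>(w :: 'a \<Rightarrow> real) (q :: real).
        (\<forall>i\<in>N. w i \<ge> 0) \<and> q > 0 \<and>
        (\<forall>S. S \<subseteq> N \<longrightarrow> (S \<in> W \<longleftrightarrow> (\<Sum>i\<in>S. w i) \<ge> q)))"

definition game_iso :: "'a set \<Rightarrow> ('a set set \<times> 'a set set) set" where
  "game_iso N =
     {(W, W'). simple_game N W \<and> simple_game N W' \<and>
        (\<exists>f. bij_betw f N N \<and> (\<forall>S. S \<subseteq> N \<longrightarrow> (S \<in> W \<longleftrightarrow> f ` S \<in> W')))}"

definition desirable :: "'a set \<Rightarrow> 'a set set \<Rightarrow> 'a \<Rightarrow> 'a \<Rightarrow> bool" where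
  "desirable N W i j \<longleftrightarrow>
     (\<forall>S. S \<subseteq> N - {i, j} \<longrightarrow> S \<union> {j} \<in> W \<longrightarrow> S \<union> {i} \<in> W)"

definition desir_equiv :: "'a set \<Rightarrow> 'a set set \<Rightarrow> ('a \<times> 'a) set" where
  "desir_equiv N W =
     {(i, j). i \<in> N \<and> j \<in> N \<and> desirable N W i j \<and> desirable N W j i}"

definition strictly_desirable :: "'a set \<Rightarrow> 'a set set \<Rightarrow> 'a \<Rightarrow> 'a \<Rightarrow> bool" where
  "strictly_desirable N W i j \<longleftrightarrow> desirable N W i j \<and> \<not> desirable N W j i"

text \<open>
  The list $[N_1, \dots, N_t]$ of equivalence classes in strictly decreasing order of
  desirability. It exists and is unique when desirability is total, in particular for
  weighted games on a finite player set; list positions start at 0.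
\<close>

definition class_list :: "'a set \<Rightarrow> 'a set set \<Rightarrow> 'a set list" where
  "class_list N W =
     (THE Ns. set Ns = N // desir_equiv N W \<and>
        sorted_wrt (\<lambda>A B. \<forall>i\<in>A. \<forall>j\<in>B. strictly_desirable N W i j) Ns)"

definition game_vectors :: "'a set \<Rightarrow> 'a set set \<Rightarrow> nat list set" where
  "game_vectors N W =
     {m. length m = length (class_list N W) \<and>
         (\<forall>h<length m. m ! h \<le> card (class_list N W ! h))}"

definition coalitions_of :: "'a set \<Rightarrow> 'a set set \<Rightarrow> nat list \<Rightarrow> 'a set set" where
  "coalitions_of N W m =
     {S. S \<subseteq> N \<and> (\<forall>h<length (class_list N W). card (S \<inter> class_list N W ! h) = m ! h)}"

definition winning_vector :: "'a set \<Rightarrow> 'a set set \<Rightarrow> nat list \<Rightarrow> bool" where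
  "winning_vector N W m \<longleftrightarrow>
     m \<in> game_vectors N W \<and> (\<forall>S\<in>coalitions_of N W m. S \<in> W)"

definition losing_vector :: "'a set \<Rightarrow> 'a set set \<Rightarrow> nat list \<Rightarrow> bool" where
  "losing_vector N W m \<longleftrightarrow>
     m \<in> game_vectors N W \<and> (\<forall>S\<in>coalitions_of N W m. S \<notin> W)"

definition dominates :: "nat list \<Rightarrow> nat list \<Rightarrow> bool" where
  "dominates a b \<longleftrightarrow>
     length a = length b \<and> (\<forall>k\<le>length a. sum_list (take k a) \<ge> sum_list (take k b))"

definition strictly_dominates :: "nat list \<Rightarrow> nat list \<Rightarrow> bool" where
  "strictly_dominates a b \<longleftrightarrow> dominates a b \<and> a \<noteq> b"

definition shift_minimal_winning :: "'a set \<Rightarrow> 'a set set \<Rightarrow> nat list \<Rightarrow> bool" where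
  "shift_minimal_winning N W m \<longleftrightarrow>
     winning_vector N W m \<and>
     (\<forall>m'\<in>game_vectors N W. strictly_dominates m m' \<longrightarrow> losing_vector N W m')"

definition veto_player :: "'a set \<Rightarrow> 'a set set \<Rightarrow> 'a \<Rightarrow> bool" where
  "veto_player N W i \<longleftrightarrow> i \<in> N \<and> (\<forall>S\<in>W. i \<in> S)"

definition minimal_winning :: "'a set set \<Rightarrow> 'a set \<Rightarrow> bool" where
  "minimal_winning W S \<longleftrightarrow> S \<in> W \<and> (\<forall>T. T \<subset> S \<longrightarrow> T \<notin> W)"

definition null_player :: "'a set \<Rightarrow> 'a set set \<Rightarrow> 'a \<Rightarrow> bool" where
  "null_player N W i \<longleftrightarrow> i \<in> N \<and> (\<forall>S. minimal_winning W S \<longrightarrow> i \<notin> S)"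

definition nontrivial_game :: "'a set \<Rightarrow> 'a set set \<Rightarrow> bool" where
  "nontrivial_game N W \<longleftrightarrow> (\<forall>i\<in>N. \<not> veto_player N W i \<and> \<not> null_player N W i)"

definition weighted_games :: "nat \<Rightarrow> nat \<Rightarrow> nat \<Rightarrow> nat set set set" where
  "weighted_games n t r =
     {W. weighted_game {1..n} W \<and>
         card ({1..n} // desir_equiv {1..n} W) = t \<and>
         card {m. shift_minimal_winning {1..n} W m} = r}"

definition wg :: "nat \<Rightarrow> nat \<Rightarrow> nat \<Rightarrow> nat" where
  "wg n t r = card (weighted_games n t r // game_iso {1..n})"

definition wg_hat :: "nat \<Rightarrow> nat \<Rightarrow> nat \<Rightarrow> nat" where
  "wg_hat n t r =
     card ({W \<in> weighted_games n t r. nontrivial_game {1..n} W} // game_iso {1..n})"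

end

theory Submission
  imports Defs
begin

text \<open>
  A weighted game with a unique shift-minimal winning vector \<open>m\<close> consists of the coalitions whose
  class profile dominates \<open>m\<close>, so up to isomorphism it is given by the class sizes \<open>ns\<close> and \<open>m\<close>.
  The classes are the desirability classes exactly if \<open>0 < m\<^sub>h\<close> for every class but the last and
  \<open>m\<^sub>h < ns\<^sub>h\<close> for every class but the first. Only the first class can consist of veto players
  (\<open>m\<^sub>h = ns\<^sub>h\<close>) and only the last of null players (\<open>m\<^sub>h = 0\<close>). Trading players between two
  winning coalitions of profile \<open>m\<close> shows that a weighted game has at most two further classes, and
  that \<open>m\<^sub>h \<in> {1, ns\<^sub>h - 1}\<close> for the second of them; conversely, explicit weights exist in these
  cases. This leaves \<open>(k - 3)\<^sup>2\<close> pairs on \<open>k\<close> players with two such classes and \<open>k - 1\<close> with one;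
  summing over the numbers of veto and null players gives the polynomials.
\<close>

text \<open>A prefix sum of a profile is the number of members among the most desirable players, so
  domination becomes a count of \<open>S \<inter> upper Ns k\<close> over an increasing chain of
  sets. Replacing a player of block \<open>a\<close> by one of a later block \<open>b\<close> lowers
  this count by one exactly for \<open>a < k \<le> b\<close>; this pins down which inequality of a
  winning coalition breaks.

  The trade obstruction breaks one inequality at the class of \<open>i\<close> and \<open>j\<close>
  and another at the total count. It therefore needs a core class in front of the traded players,
  which is why only the later of two core classes is restricted.

  With two core classes, winning means \<open>m \<le> x\<close> and
  \<open>m + k \<le> x + y\<close>. Two thresholds are in general not one linear test. If
  \<open>k = 1\<close>, they amount to a lexicographic comparison of \<open>(x, y)\<close> with
  \<open>(m, 1)\<close>; if \<open>k\<close> is one less than the class size, of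
  \<open>(x + y, x)\<close> with \<open>(m + k, m)\<close>. The entries are bounded, so a large
  enough factor on the leading coordinate turns either comparison into a linear inequality, and the
  weights are read off from it.\<close>

definition upper :: "'a set list \<Rightarrow> nat \<Rightarrow> 'a set" where
  "upper Ns k = \<Union> (set (take k Ns))"

definition profile :: "'a set list \<Rightarrow> 'a set \<Rightarrow> nat list" where
  "profile Ns S = map (\<lambda>A. card (S \<inter> A)) Ns"

definition vector_game :: "'a set \<Rightarrow> 'a set list \<Rightarrow> nat list \<Rightarrow> 'a set set" where
  "vector_game N Ns m = {S. S \<subseteq> N \<and> dominates (profile Ns S) m}"

text \<open>This is the property under the description operator in \<open>class_list\<close>. As a
  predicate it can be proved for a chain at hand, and \<open>class_list_eq\<close> then identifies
  that chain with \<open>class_list\<close>.\<close>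

definition class_chain :: "'a set \<Rightarrow> 'a set set \<Rightarrow> 'a set list \<Rightarrow> bool" where
  "class_chain N W Ns \<longleftrightarrow> set Ns = N // desir_equiv N W \<and>
     sorted_wrt (\<lambda>A B. \<forall>i\<in>A. \<forall>j\<in>B. strictly_desirable N W i j) Ns"

text \<open>The last conjunct provides, for neighbouring classes, a coalition of profile
  \<open>m\<close> that contains a player of the former and misses one of the latter. With a single
  class it is vacuous, and \<open>0 < m ! 0\<close> is what keeps the empty coalition
  losing.\<close>

definition admissible :: "nat list \<Rightarrow> nat list \<Rightarrow> bool" where
  "admissible ns m \<longleftrightarrow> length m = length ns \<and> ns \<noteq> [] \<and> 0 < m ! 0 \<and>
     (\<forall>h<length ns. m ! h \<le> ns ! h \<and> 0 < ns ! h) \<and>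
     (\<forall>h. Suc h < length ns \<longrightarrow> 0 < m ! h \<and> m ! Suc h < ns ! Suc h)"

section \<open>The domination order on vectors\<close>

lemma sum_list_take_Suc:
  fixes m :: "nat list"
  shows "k < length m \<Longrightarrow> sum_list (take (Suc k) m) = sum_list (take k m) + m ! k"
  by (simp add: take_Suc_conv_app_nth)

lemma length_profile [simp]: "length (profile Ns S) = length Ns"
  by (simp add: profile_def)

lemma nth_profile [simp]: "h < length Ns \<Longrightarrow> profile Ns S ! h = card (S \<inter> Ns ! h)"
  by (simp add: profile_def)

lemma dominates_refl: "dominates a a"
  by (simp add: dominates_def)

lemma dominates_trans: "dominates a b \<Longrightarrow> dominates b c \<Longrightarrow> dominates a c"
  unfolding dominates_def by (metis le_trans)

lemma dominates_antisym:
  assumes "dominates a b" "dominates b a"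
  shows "a = b"
proof (rule nth_equalityI)
  show len: "length a = length b" using assms by (simp add: dominates_def)
  fix k assume k: "k < length a"
  have eq: "sum_list (take j a) = sum_list (take j b)" if "j \<le> length a" for j
    using assms that len by (auto simp: dominates_def intro: le_antisym)
  show "a ! k = b ! k"
    using eq[of k] eq[of "Suc k"] k len by (simp add: sum_list_take_Suc)
qed

section \<open>Ordered partitions of the player set\<close>

text \<open>Desirability does not occur here, so the same counting lemmas apply to the classes of a
  given game and to a partition from which a game is yet to be built.\<close>

locale ordered_partition =
  fixes N :: "'a set" and Ns :: "'a set list"
  assumes finite_players: "finite N"
    and Union_blocks: "\<Union> (set Ns) = N"
    and block_nonempty: "A \<in> set Ns \<Longrightarrow> A \<noteq> {}"
    and block_disjoint: "a < length Ns \<Longrightarrow> b < length Ns \<Longrightarrow> a \<noteq> b \<Longrightarrow> Ns ! a \<inter> Ns ! b = {}"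
begin

lemma block_subset: "a < length Ns \<Longrightarrow> Ns ! a \<subseteq> N"
  using Union_blocks by auto

lemma finite_block: "a < length Ns \<Longrightarrow> finite (Ns ! a)"
  using block_subset finite_players finite_subset by blast

lemma block_mem: "i \<in> N \<Longrightarrow> \<exists>a<length Ns. i \<in> Ns ! a"
  using Union_blocks by (metis UnionE in_set_conv_nth)

lemma block_unique: "a < length Ns \<Longrightarrow> b < length Ns \<Longrightarrow> i \<in> Ns ! a \<Longrightarrow> i \<in> Ns ! b \<Longrightarrow> a = b"
  using block_disjoint by blast

lemma upper_subset: "upper Ns k \<subseteq> N"
  using Union_blocks set_take_subset[of k Ns] by (auto simp: upper_def)

lemma upper_0 [simp]: "upper Ns 0 = {}"
  by (simp add: upper_def)

lemma upper_length [simp]: "upper Ns (length Ns) = N"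
  using Union_blocks by (simp add: upper_def)

lemma upper_Suc: "k < length Ns \<Longrightarrow> upper Ns (Suc k) = upper Ns k \<union> Ns ! k"
  by (auto simp: upper_def take_Suc_conv_app_nth)

lemma mem_upper:
  assumes "a < length Ns" "i \<in> Ns ! a" "k \<le> length Ns"
  shows "i \<in> upper Ns k \<longleftrightarrow> a < k"
proof
  assume "i \<in> upper Ns k"
  then obtain b where "b < k" "b < length Ns" "i \<in> Ns ! b"
    by (auto simp: upper_def in_set_conv_nth)
  then show "a < k" using block_unique assms by blast
next
  assume "a < k"
  then have "Ns ! a \<in> set (take k Ns)"
    using assms by (metis length_take min.absorb2 nth_mem nth_take)
  then show "i \<in> upper Ns k"
    using assms by (auto simp: upper_def)
qed

lemma upper_disjoint: "k < length Ns \<Longrightarrow> upper Ns k \<inter> Ns ! k = {}"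
  using mem_upper by fastforce

lemma finite_inter_upper: "finite (S \<inter> upper Ns k)"
  using upper_subset finite_players by (meson finite_Int finite_subset)

lemma card_inter_upper_Suc:
  assumes "k < length Ns"
  shows "card (S \<inter> upper Ns (Suc k)) = card (S \<inter> upper Ns k) + card (S \<inter> Ns ! k)"
proof -
  have "S \<inter> upper Ns (Suc k) = (S \<inter> upper Ns k) \<union> (S \<inter> Ns ! k)"
    using upper_Suc[OF assms] by auto
  then show ?thesis
    using upper_disjoint[OF assms] finite_inter_upper finite_block[OF assms]
    by (simp add: card_Un_disjoint disjoint_iff)
qed

lemma sum_take_profile:
  "k \<le> length Ns \<Longrightarrow> sum_list (take k (profile Ns S)) = card (S \<inter> upper Ns k)"
proof (induction k)
  case (Suc k)
  then show ?case by (simp add: sum_list_take_Suc card_inter_upper_Suc)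
qed simp

lemma mem_vector_game:
  "S \<in> vector_game N Ns m \<longleftrightarrow> S \<subseteq> N \<and> length m = length Ns \<and>
     (\<forall>k\<le>length Ns. sum_list (take k m) \<le> card (S \<inter> upper Ns k))"
  by (auto simp: vector_game_def dominates_def sum_take_profile)

text \<open>Blocks are disjoint, so each prescribed cardinality is realised separately inside its
  block, between the required part of \<open>I\<close> and the part outside \<open>J\<close>. This
  supplies coalitions of profile \<open>m\<close> with chosen members and chosen
  non-members.\<close>

lemma coalition_with_profile:
  assumes "length m = length Ns" "I \<subseteq> N" "I \<inter> J = {}"
    and bnd: "\<And>h. h < length Ns \<Longrightarrow>
      card (I \<inter> Ns ! h) \<le> m ! h \<and> m ! h \<le> card (Ns ! h - J)"
  shows "\<exists>T\<subseteq>N. I \<subseteq> T \<and> T \<inter> J = {} \<and> profile Ns T = m"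
proof -
  have "\<exists>B. I \<inter> Ns ! h \<subseteq> B \<and> B \<subseteq> Ns ! h - J \<and> card B = m ! h" if "h < length Ns" for h
    using exists_subset_between[of "I \<inter> Ns ! h" "m ! h" "Ns ! h - J"] bnd[OF that]
      assms(3) finite_block[OF that] by blast
  then obtain B where B: "\<And>h. h < length Ns \<Longrightarrow>
      I \<inter> Ns ! h \<subseteq> B h \<and> B h \<subseteq> Ns ! h - J \<and> card (B h) = m ! h"
    by metis
  define T where "T = (\<Union>h<length Ns. B h)"
  have inter: "T \<inter> Ns ! h = B h" if h: "h < length Ns" for h
  proof
    show "B h \<subseteq> T \<inter> Ns ! h" using B h by (auto simp: T_def)
    show "T \<inter> Ns ! h \<subseteq> B h"
    proof
      fix i assume i: "i \<in> T \<inter> Ns ! h"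
      then obtain h' where h': "h' < length Ns" "i \<in> B h'" by (auto simp: T_def)
      then have "i \<in> Ns ! h'" using B by blast
      then show "i \<in> B h" using block_unique i h h' by blast
    qed
  qed
  have "T \<subseteq> N" unfolding T_def using B block_subset by blast
  moreover have "T \<inter> J = {}" unfolding T_def using B by blast
  moreover have "I \<subseteq> T"
  proof
    fix i assume i: "i \<in> I"
    then obtain h where h: "h < length Ns" "i \<in> Ns ! h" using block_mem assms(2) by blast
    then show "i \<in> T" unfolding T_def using B[OF h(1)] i by blast
  qed
  moreover have "profile Ns T = m"
    using inter B assms(1) by (intro nth_equalityI) simp_all
  ultimately show ?thesis by blast
qed

lemma card_inter_upper_profile:
  "profile Ns T = m \<Longrightarrow> k \<le> length Ns \<Longrightarrow> card (T \<inter> upper Ns k) = sum_list (take k m)"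
  using sum_take_profile by metis

lemma profile_in_vector_game:
  "T \<subseteq> N \<Longrightarrow> profile Ns T = m \<Longrightarrow> T \<in> vector_game N Ns m"
  by (auto simp: mem_vector_game card_inter_upper_profile)

lemma card_exchange_upper:
  assumes "i \<in> Ns ! a" "a < length Ns" "j \<in> Ns ! b" "b < length Ns"
    "i \<notin> S" "j \<notin> S" "k \<le> length Ns"
  shows "card (insert i S \<inter> upper Ns k) = card (S \<inter> upper Ns k) + of_bool (a < k)"
    "card (insert j S \<inter> upper Ns k) = card (S \<inter> upper Ns k) + of_bool (b < k)"
  using assms mem_upper finite_inter_upper by (simp_all add: Int_insert_left)

end

section \<open>Desirability and the chain of its classes\<close>

lemma desirable_refl: "desirable N W i i"
  by (simp add: desirable_def)

lemma desirable_trans: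
  assumes "desirable N W i j" "desirable N W j k"
    and "i \<in> N" "j \<in> N" "k \<in> N"
  shows "desirable N W i k"
proof (cases "i = j \<or> j = k \<or> i = k")
  case True
  then show ?thesis using assms by (auto simp: desirable_refl)
next
  case False
  show ?thesis
    unfolding desirable_def
  proof (intro allI impI)
    fix T assume T: "T \<subseteq> N - {i, k}" "T \<union> {k} \<in> W"
    show "T \<union> {i} \<in> W"
    proof (cases "j \<in> T")
      case False
      then have "T \<union> {j} \<in> W" using assms(2) T unfolding desirable_def by blast
      moreover have "T \<subseteq> N - {i, j}" using T False by blast
      ultimately show ?thesis using assms(1) unfolding desirable_def by blast
    next
      \<comment> \<open>With \<open>j\<close> already in \<open>T\<close>, the other order of
        exchanges works: \<open>i\<close> takes the place of \<open>j\<close>, and \<open>j\<close>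
        then returns in the place of \<open>k\<close>.\<close>
      case True
      define S where "S = T - {j}"
      have S: "T = S \<union> {j}" "j \<notin> S" using True by (auto simp: S_def)
      have "S \<union> {k} \<subseteq> N - {i, j}" "(S \<union> {k}) \<union> {j} \<in> W"
        using T S assms(5) False by (auto simp: insert_commute)
      then have "(S \<union> {k}) \<union> {i} \<in> W" using assms(1) unfolding desirable_def by blast
      then have "S \<union> {i} \<subseteq> N - {j, k}" "(S \<union> {i}) \<union> {k} \<in> W"
        using T S assms(3) False by (auto simp: insert_commute)
      then have "(S \<union> {i}) \<union> {j} \<in> W" using assms(2) unfolding desirable_def by blast
      then show ?thesis using S by (simp add: insert_commute)
    qed
  qed
qed

lemma equiv_desir_equiv: "equiv N (desir_equiv N W)"
proof (rule equivI)
  show "desir_equiv N W \<subseteq> N \<times> N" by (auto simp: desir_equiv_def)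
  show "refl_on N (desir_equiv N W)"
    by (auto simp: refl_on_def desir_equiv_def desirable_refl)
  show "sym (desir_equiv N W)" by (auto simp: sym_def desir_equiv_def)
  show "trans (desir_equiv N W)"
  proof (rule transI)
    fix i j k assume "(i, j) \<in> desir_equiv N W" "(j, k) \<in> desir_equiv N W"
    then show "(i, k) \<in> desir_equiv N W"
      using desirable_trans[of N W i j k] desirable_trans[of N W k j i]
      by (simp add: desir_equiv_def)
  qed
qed

lemma class_chain_partition:
  assumes "class_chain N W Ns" "finite N"
  shows "ordered_partition N Ns"
proof
  have eq: "equiv N (desir_equiv N W)" by (rule equiv_desir_equiv)
  have S: "set Ns = N // desir_equiv N W" using assms by (simp add: class_chain_def)
  show "finite N" by fact
  show "\<Union> (set Ns) = N" using Union_quotient[OF eq] S by simp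
  show ne: "A \<noteq> {}" if "A \<in> set Ns" for A
    using in_quotient_imp_non_empty[OF eq] that S by simp
  \<comment> \<open>A common player would be strictly more desirable than itself.\<close>
  have "Ns ! a \<inter> Ns ! b = {}" if ab: "a < b" "b < length Ns" for a b
  proof -
    have "strictly_desirable N W i j" if "i \<in> Ns ! a" "j \<in> Ns ! b" for i j
      using assms ab that by (auto simp: class_chain_def sorted_wrt_iff_nth_less)
    then show ?thesis unfolding strictly_desirable_def by blast
  qed
  then show "Ns ! a \<inter> Ns ! b = {}" if "a < length Ns" "b < length Ns" "a \<noteq> b" for a b
    using that by (metis Int_commute nat_neq_iff)
qed

lemma class_chain_strict:
  assumes "class_chain N W Ns" "a < b" "b < length Ns" "i \<in> Ns ! a" "j \<in> Ns ! b"
  shows "strictly_desirable N W i j"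
  using assms by (auto simp: class_chain_def sorted_wrt_iff_nth_less)

lemma class_chain_desirable:
  assumes "class_chain N W Ns" "a \<le> b" "b < length Ns" "i \<in> Ns ! a" "j \<in> Ns ! b"
  shows "desirable N W i j"
proof (cases "a = b")
  case True
  then have "Ns ! a \<in> N // desir_equiv N W"
    using assms by (metis class_chain_def nth_mem)
  then have "(i, j) \<in> desir_equiv N W"
    using quotient_eq_iff[OF equiv_desir_equiv] assms True by fastforce
  then show ?thesis by (simp add: desir_equiv_def)
next
  case False
  then have "strictly_desirable N W i j" using assms by (intro class_chain_strict) auto
  then show ?thesis by (simp add: strictly_desirable_def)
qed

text \<open>Two different heads would each be related to the other. Asymmetry is assumed on the
  members only, because the relation between classes used below holds vacuously as soon as one of
  the sets is empty.\<close>

lemma sorted_wrt_unique: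
  assumes "sorted_wrt R xs" "sorted_wrt R ys" "set xs = set ys"
    and asym: "\<And>x y. x \<in> set xs \<Longrightarrow> y \<in> set xs \<Longrightarrow> R x y \<Longrightarrow> \<not> R y x"
  shows "xs = ys"
  using assms
proof (induction xs arbitrary: ys)
  case (Cons x xs)
  note sx = Cons.prems(1) and sy = Cons.prems(2) and eq = Cons.prems(3) and as = Cons.prems(4)
  obtain y ys' where ys: "ys = y # ys'" using eq by (cases ys) auto
  have x: "R x z" if "z \<in> set xs" for z using sx that by simp
  have y: "R y z" if "z \<in> set ys'" for z using sy that ys by simp
  have "x = y"
  proof (rule ccontr)
    assume "x \<noteq> y"
    then have "y \<in> set xs" "x \<in> set ys'" using eq ys by (auto simp: set_eq_iff)
    then show False using x y as[of x y] by simp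
  qed
  moreover have "x \<notin> set xs" using x as[of x x] by auto
  moreover have "y \<notin> set ys'" using y as[of y y] eq ys by auto
  ultimately have "set xs = set ys'" using eq ys by (simp add: insert_eq_iff)
  moreover have "sorted_wrt R xs" "sorted_wrt R ys'" using sx sy ys by simp_all
  ultimately have "xs = ys'" using as by (intro Cons.IH) (auto simp del: set_eq_iff)
  with \<open>x = y\<close> ys show ?case by simp
qed simp

lemma class_chain_unique:
  assumes "class_chain N W Ns" "class_chain N W Ns'"
  shows "Ns = Ns'"
proof (rule sorted_wrt_unique)
  let ?R = "\<lambda>A B. \<forall>i\<in>A. \<forall>j\<in>B. strictly_desirable N W i j"
  show "sorted_wrt ?R Ns" "sorted_wrt ?R Ns'" "set Ns = set Ns'"
    using assms by (auto simp: class_chain_def)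
  fix A B assume "A \<in> set Ns" "B \<in> set Ns" and AB: "?R A B"
  then have "A \<noteq> {}" "B \<noteq> {}"
    using assms in_quotient_imp_non_empty[OF equiv_desir_equiv]
    by (metis class_chain_def)+
  then show "\<not> ?R B A" using AB unfolding strictly_desirable_def by blast
qed

lemma class_list_eq: "class_chain N W Ns \<Longrightarrow> class_list N W = Ns"
  unfolding class_list_def class_chain_def[symmetric]
  by (blast intro: the_equality class_chain_unique)

text \<open>A player of larger weight is at least as desirable, so weights make desirability total.
  Equivalent players may have different weights; hence each class is represented by one chosen
  player and the classes are sorted by the weights of these.\<close>

lemma weighted_class_chain:
  assumes "weighted_game N W" "finite N"
  obtains Ns where "class_chain N W Ns"
proof -
  obtain w :: "'a \<Rightarrow> real" and q where
    W: "\<And>S. S \<subseteq> N \<Longrightarrow> S \<in> W \<longleftrightarrow> q \<le> (\<Sum>i\<in>S. w i)"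
    using assms(1) unfolding weighted_game_def by blast
  have des: "desirable N W i j" if "w j \<le> w i" "i \<in> N" "j \<in> N" for i j
    unfolding desirable_def
  proof (intro allI impI)
    fix S assume S: "S \<subseteq> N - {i, j}" "S \<union> {j} \<in> W"
    then have "finite S" "i \<notin> S" "j \<notin> S" using assms(2) finite_subset by blast+
    then have "(\<Sum>k\<in>S \<union> {j}. w k) \<le> (\<Sum>k\<in>S \<union> {i}. w k)" using that by simp
    moreover have "S \<union> {j} \<subseteq> N" "S \<union> {i} \<subseteq> N" using S that by auto
    ultimately show "S \<union> {i} \<in> W" using S W by force
  qed
  let ?C = "N // desir_equiv N W"
  let ?R = "\<lambda>A B. \<forall>i\<in>A. \<forall>j\<in>B. strictly_desirable N W i j"
  have eq: "equiv N (desir_equiv N W)" by (rule equiv_desir_equiv)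
  have cls: "A \<subseteq> N" "A \<noteq> {}" if "A \<in> ?C" for A
    using that in_quotient_imp_subset[OF eq] in_quotient_imp_non_empty[OF eq] by auto
  \<comment> \<open>The sign turns the ascending order of \<open>sort_key\<close> into decreasing
    weight.\<close>
  define key where "key A = - w (SOME i. i \<in> A)" for A
  have rep: "(SOME i. i \<in> A) \<in> A" if "A \<in> ?C" for A
    using cls[OF that] some_in_eq by blast
  have step: "?R A B" if A: "A \<in> ?C" and B: "B \<in> ?C" and "A \<noteq> B" "key A \<le> key B" for A B
  proof (intro ballI)
    fix i j assume ij: "i \<in> A" "j \<in> B"
    let ?a = "SOME i. i \<in> A" and ?b = "SOME i. i \<in> B"
    have N: "i \<in> N" "j \<in> N" "?a \<in> N" "?b \<in> N" using ij rep cls A B by blast+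
    have ab: "desirable N W ?a ?b" using that N by (intro des) (auto simp: key_def)
    have "(i, ?a) \<in> desir_equiv N W" "(j, ?b) \<in> desir_equiv N W"
      using quotient_eq_iff[OF eq A A ij(1) rep[OF A]] quotient_eq_iff[OF eq B B ij(2) rep[OF B]]
      by simp_all
    then have "desirable N W i ?a" "desirable N W ?b j" unfolding desir_equiv_def by blast+
    then have "desirable N W i j" using ab desirable_trans N by metis
    moreover have "(i, j) \<notin> desir_equiv N W"
      using quotient_eq_iff[OF eq A B ij] that by blast
    ultimately show "strictly_desirable N W i j"
      using N by (auto simp: strictly_desirable_def desir_equiv_def)
  qed
  have "finite ?C" by (rule finite_quotient) (use assms(2) eq in \<open>auto simp: desir_equiv_def\<close>)
  then obtain xs where xs: "set xs = ?C" "distinct xs" using finite_distinct_list by blast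
  define Ns where "Ns = sort_key key xs"
  have Ns: "set Ns = ?C" "distinct Ns" "sorted (map key Ns)" using xs by (auto simp: Ns_def)
  have "sorted_wrt ?R Ns"
    unfolding sorted_wrt_iff_nth_less
  proof (intro allI impI)
    fix a b assume ab: "a < b" "b < length Ns"
    then have "key (Ns ! a) \<le> key (Ns ! b)"
      using Ns(3) by (simp add: sorted_iff_nth_mono_less)
    moreover have "Ns ! a \<noteq> Ns ! b" using ab Ns(2) by (simp add: nth_eq_iff_index_eq)
    moreover have "Ns ! a \<in> ?C" "Ns ! b \<in> ?C" using ab Ns(1) nth_mem[of _ Ns] by auto
    ultimately show "?R (Ns ! a) (Ns ! b)" by (intro step)
  qed
  then show ?thesis using that Ns by (auto simp: class_chain_def)
qed

subsection \<open>Shift-minimal vectors\<close>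

text \<open>\<open>T\<close> is transformed into a subset of \<open>S\<close> by single exchanges,
  each of which replaces a player outside \<open>S\<close> by an at least as desirable player of
  \<open>S\<close> and so preserves winning. Choosing the replaced player \<open>j\<close> in the
  first block \<open>k\<close> that meets \<open>T - S\<close> keeps the prefix inequalities: up to
  \<open>k\<close> the new coalition stays inside \<open>S\<close>, and all longer prefixes contain
  both exchanged players.\<close>

lemma winning_exchange:
  assumes chain: "class_chain N W Ns" and fin: "finite N" and game: "simple_game N W"
    and "T \<in> W" "S \<subseteq> N"
    and "\<And>k. k \<le> length Ns \<Longrightarrow> card (T \<inter> upper Ns k) \<le> card (S \<inter> upper Ns k)"
  shows "S \<in> W"
proof -
  interpret ordered_partition N Ns by (rule class_chain_partition[OF chain fin])
  show ?thesis
    using assms(4,6)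
  proof (induction "card (T - S)" arbitrary: T rule: less_induct)
    case less
    note le = less.prems(2)
    have T: "T \<subseteq> N" using less.prems(1) game by (auto simp: simple_game_def)
    show ?case
    proof (cases "T \<subseteq> S")
      case True
      then show ?thesis using less.prems(1) game \<open>S \<subseteq> N\<close> unfolding simple_game_def by blast
    next
      case False
      define k where "k = (LEAST a. a < length Ns \<and> (T - S) \<inter> Ns ! a \<noteq> {})"
      have "\<exists>a. a < length Ns \<and> (T - S) \<inter> Ns ! a \<noteq> {}" using False T block_mem by blast
      then have k: "k < length Ns" "(T - S) \<inter> Ns ! k \<noteq> {}"
        unfolding k_def by (metis (mono_tags, lifting) LeastI)+
      have least: "k \<le> a" if "a < length Ns" "(T - S) \<inter> Ns ! a \<noteq> {}" for a
        unfolding k_def using that by (intro Least_le) blast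
      obtain j where j: "j \<in> T" "j \<notin> S" "j \<in> Ns ! k" using k by blast
      have sub: "T \<inter> upper Ns l \<subseteq> S" if "l \<le> k" for l
      proof
        fix x assume x: "x \<in> T \<inter> upper Ns l"
        then obtain a where a: "a < length Ns" "x \<in> Ns ! a" using T block_mem by blast
        then have "a < l" using x mem_upper that k by auto
        then show "x \<in> S" using least[OF a(1)] a x that by fastforce
      qed
      \<comment> \<open>Otherwise \<open>S\<close> would be contained in \<open>T\<close> on this
        prefix, properly because of \<open>j\<close>, against the inequality of the counts.\<close>
      have "\<exists>i. i \<in> S \<and> i \<notin> T \<and> i \<in> upper Ns (Suc k)"
      proof (rule ccontr)
        assume "\<not> ?thesis"
        moreover have "j \<in> upper Ns (Suc k)" using j k by (simp add: upper_Suc)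
        ultimately have "S \<inter> upper Ns (Suc k) \<subset> T \<inter> upper Ns (Suc k)" using j by blast
        then have "card (S \<inter> upper Ns (Suc k)) < card (T \<inter> upper Ns (Suc k))"
          using finite_inter_upper by (intro psubset_card_mono)
        then show False using le[of "Suc k"] k by simp
      qed
      then obtain i where i: "i \<in> S" "i \<notin> T" "i \<in> upper Ns (Suc k)" by blast
      then obtain a where a: "a < length Ns" "i \<in> Ns ! a" using \<open>S \<subseteq> N\<close> block_mem by blast
      then have ak: "a \<le> k" using i k mem_upper[of a i "Suc k"] by simp
      define T' where "T' = insert i (T - {j})"
      have "desirable N W i j" using class_chain_desirable[OF chain ak k(1) a(2) j(3)] .
      moreover have "T - {j} \<subseteq> N - {i, j}" "(T - {j}) \<union> {j} \<in> W"
        using T i j less.prems(1) by (auto simp: insert_absorb)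
      ultimately have T': "T' \<in> W" unfolding desirable_def T'_def by auto
      have "T' - S = (T - S) - {j}" using i j by (auto simp: T'_def)
      then have "card (T' - S) < card (T - S)"
        using j T fin by (metis DiffI card_Diff1_less finite_Diff finite_subset)
      moreover have "card (T' \<inter> upper Ns l) \<le> card (S \<inter> upper Ns l)" if l: "l \<le> length Ns" for l
      proof (cases "l \<le> k")
        case True
        then have "T' \<inter> upper Ns l \<subseteq> S \<inter> upper Ns l" using sub[OF True] i by (auto simp: T'_def)
        then show ?thesis by (intro card_mono finite_inter_upper)
      next
        case False
        have "card (T' \<inter> upper Ns l) = card (insert j (T - {j}) \<inter> upper Ns l)"
          unfolding T'_def
          using card_exchange_upper[OF a(2,1) j(3) k(1), of "T - {j}" l] i l False ak by simp
        then show ?thesis using le[OF l] j(1) by (simp add: insert_absorb)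
      qed
      ultimately show ?thesis using less.hyps T' by blast
    qed
  qed
qed

lemma game_vectors_eq:
  assumes "class_chain N W Ns"
  shows "game_vectors N W = {m. length m = length Ns \<and> (\<forall>h<length Ns. m ! h \<le> card (Ns ! h))}"
  by (auto simp: game_vectors_def class_list_eq[OF assms])

lemma coalitions_of_eq:
  assumes "class_chain N W Ns" "length m = length Ns"
  shows "coalitions_of N W m = {S. S \<subseteq> N \<and> profile Ns S = m}"
  using assms(2) by (auto simp: coalitions_of_def class_list_eq[OF assms(1)] list_eq_iff_nth_eq)

lemma (in ordered_partition) game_vector_profile:
  assumes "length m = length Ns" "\<And>h. h < length Ns \<Longrightarrow> m ! h \<le> card (Ns ! h)"
  obtains T where "T \<subseteq> N" "profile Ns T = m"
  using coalition_with_profile[of m "{}" "{}"] assms by auto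

text \<open>Equal profiles have equal prefix counts, so \<open>winning_exchange\<close> applies in
  both directions. Consequently no vector is left undecided between winning and losing.\<close>

lemma winning_losing_profile:
  assumes chain: "class_chain N W Ns" and fin: "finite N" and game: "simple_game N W"
    and T: "T \<subseteq> N"
  shows "winning_vector N W (profile Ns T) \<longleftrightarrow> T \<in> W"
    and "losing_vector N W (profile Ns T) \<longleftrightarrow> T \<notin> W"
proof -
  interpret ordered_partition N Ns by (rule class_chain_partition[OF chain fin])
  have "profile Ns T \<in> game_vectors N W"
    using finite_block by (auto simp: game_vectors_eq[OF chain] intro: card_mono)
  moreover have "S \<in> W \<longleftrightarrow> T \<in> W" if "S \<subseteq> N" "profile Ns S = profile Ns T" for S
  proof -
    have "card (S \<inter> upper Ns k) = card (T \<inter> upper Ns k)" if "k \<le> length Ns" for k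
      using sum_take_profile that \<open>profile Ns S = profile Ns T\<close> by metis
    then show ?thesis
      using winning_exchange[OF chain fin game, of S T]
        winning_exchange[OF chain fin game, of T S] that(1) T by auto
  qed
  ultimately show "winning_vector N W (profile Ns T) \<longleftrightarrow> T \<in> W"
    "losing_vector N W (profile Ns T) \<longleftrightarrow> T \<notin> W"
    unfolding winning_vector_def losing_vector_def coalitions_of_eq[OF chain length_profile]
    using T by blast+
qed

text \<open>The sum of all prefix sums is a natural number that drops along strict domination, so
  below every winning vector a shift-minimal one can be found by minimising it.\<close>

lemma strictly_dominates_potential:
  assumes "strictly_dominates a b"
  shows "(\<Sum>k\<le>length b. sum_list (take k b)) < (\<Sum>k\<le>length a. sum_list (take k a))"
proof -
  have len: "length a = length b"
    and le: "\<And>k. k \<le> length a \<Longrightarrow> sum_list (take k b) \<le> sum_list (take k a)"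
    using assms by (auto simp: strictly_dominates_def dominates_def)
  have "\<not> dominates b a" using assms dominates_antisym strictly_dominates_def by blast
  then obtain k where "k \<le> length a" "sum_list (take k b) < sum_list (take k a)"
    using len by (auto simp: dominates_def not_le)
  then have "(\<Sum>k\<le>length a. sum_list (take k b)) < (\<Sum>k\<le>length a. sum_list (take k a))"
    using le by (intro sum_strict_mono_ex1[of "{..length a}"]) auto
  then show ?thesis using len by simp
qed

text \<open>Among the winning vectors dominated by a given winning profile, one of least potential
  is shift-minimal and so equals the unique \<open>m\<close>. Thus every winning profile dominates
  \<open>m\<close>; the converse is \<open>winning_exchange\<close>.\<close>

lemma unique_shift_minimal_vector_game:
  assumes chain: "class_chain N W Ns" and fin: "finite N" and game: "simple_game N W"
    and one: "card {m. shift_minimal_winning N W m} = 1"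
  obtains m where "m \<in> game_vectors N W" "W = vector_game N Ns m"
proof -
  interpret ordered_partition N Ns by (rule class_chain_partition[OF chain fin])
  obtain m where m: "{m. shift_minimal_winning N W m} = {m}"
    using one card_1_singletonE by blast
  then have "shift_minimal_winning N W m" by blast
  then have win: "winning_vector N W m" by (simp add: shift_minimal_winning_def)
  then have gv: "m \<in> game_vectors N W" by (simp add: winning_vector_def)
  have "S \<in> W \<longleftrightarrow> S \<subseteq> N \<and> dominates (profile Ns S) m" for S
  proof
    assume S: "S \<in> W"
    then have SN: "S \<subseteq> N" using game by (auto simp: simple_game_def)
    let ?P = "\<lambda>x. winning_vector N W x \<and> dominates (profile Ns S) x"
    let ?f = "\<lambda>x. \<Sum>k\<le>length x. sum_list (take k x)"
    have "?P (profile Ns S)"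
      using winning_losing_profile[OF chain fin game SN] S by (simp add: dominates_refl)
    then obtain x where x: "?P x" and least: "\<And>y. ?P y \<Longrightarrow> ?f x \<le> ?f y"
      using ex_has_least_nat[of ?P "profile Ns S" ?f] by blast
    have "losing_vector N W y" if y: "y \<in> game_vectors N W" "strictly_dominates x y" for y
    proof -
      obtain T where T: "T \<subseteq> N" "profile Ns T = y"
        using game_vector_profile y(1) by (auto simp: game_vectors_eq[OF chain])
      have "\<not> ?P y" using least[of y] strictly_dominates_potential[OF y(2)] by auto
      moreover have "dominates (profile Ns S) y"
        using x y(2) dominates_trans by (auto simp: strictly_dominates_def)
      ultimately show ?thesis
        using winning_losing_profile[OF chain fin game T(1)] T(2) by auto
    qed
    then have "shift_minimal_winning N W x" using x by (simp add: shift_minimal_winning_def)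
    then have "x = m" using m by blast
    then show "S \<subseteq> N \<and> dominates (profile Ns S) m" using x SN by simp
  next
    assume S: "S \<subseteq> N \<and> dominates (profile Ns S) m"
    obtain T where T: "T \<subseteq> N" "profile Ns T = m"
      using game_vector_profile gv by (auto simp: game_vectors_eq[OF chain])
    then have "T \<in> W" using winning_losing_profile[OF chain fin game T(1)] win by simp
    moreover have "card (T \<inter> upper Ns k) \<le> card (S \<inter> upper Ns k)" if "k \<le> length Ns" for k
      using S T that by (auto simp: dominates_def simp flip: sum_take_profile)
    ultimately show "S \<in> W" using winning_exchange[OF chain fin game] S by blast
  qed
  then have "W = vector_game N Ns m" by (auto simp: vector_game_def)
  then show ?thesis using that gv by blast
qed

text \<open>The winning vectors are those that dominate \<open>m\<close>. By antisymmetry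
  \<open>m\<close> is the least of them, and each other one has \<open>m\<close> strictly below
  it.\<close>

lemma shift_minimal_vector_game:
  assumes chain: "class_chain N W Ns" and fin: "finite N" and game: "simple_game N W"
    and W: "W = vector_game N Ns m" and gv: "m \<in> game_vectors N W"
  shows "{m. shift_minimal_winning N W m} = {m}"
proof -
  interpret ordered_partition N Ns by (rule class_chain_partition[OF chain fin])
  have prof: "\<exists>T\<subseteq>N. profile Ns T = x" if "x \<in> game_vectors N W" for x
    using that unfolding game_vectors_eq[OF chain] by (blast elim: game_vector_profile)
  have mem: "T \<in> W \<longleftrightarrow> dominates (profile Ns T) m" if "T \<subseteq> N" for T
    using that by (simp add: W vector_game_def)
  have win: "winning_vector N W x \<longleftrightarrow> x \<in> game_vectors N W \<and> dominates x m" for x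
    using prof[of x] winning_losing_profile(1)[OF chain fin game] mem
    by (metis winning_vector_def)
  have lose: "losing_vector N W x \<longleftrightarrow> x \<in> game_vectors N W \<and> \<not> dominates x m" for x
    using prof[of x] winning_losing_profile(2)[OF chain fin game] mem
    by (metis losing_vector_def)
  show ?thesis
    using gv by (auto simp: shift_minimal_winning_def win lose strictly_dominates_def
        dominates_refl dest: dominates_antisym)
qed

section \<open>Admissible pairs and strictness between classes\<close>

text \<open>Strictness between neighbouring classes yields a coalition \<open>S\<close> that wins
  with \<open>i\<close> and loses with \<open>j\<close>. Comparing its counts on the prefixes
  \<open>h\<close>, \<open>Suc h\<close> and \<open>Suc (Suc h)\<close> bounds the two entries of
  \<open>m\<close>.\<close>

lemma vector_game_admissible:
  assumes chain: "class_chain N W Ns" and fin: "finite N" and game: "simple_game N W"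
    and W: "W = vector_game N Ns m" and gv: "m \<in> game_vectors N W"
  shows "admissible (map card Ns) m"
proof -
  interpret ordered_partition N Ns by (rule class_chain_partition[OF chain fin])
  have len: "length m = length Ns" and le: "\<And>h. h < length Ns \<Longrightarrow> m ! h \<le> card (Ns ! h)"
    using gv by (auto simp: game_vectors_eq[OF chain])
  have emp: "{} \<notin> W" "N \<in> W" using game by (auto simp: simple_game_def)
  then have ne: "Ns \<noteq> []" using Union_blocks by auto
  have pos: "0 < card (Ns ! h)" if "h < length Ns" for h
    using block_nonempty finite_block that by (simp add: card_gt_0_iff)
  have step: "0 < m ! h \<and> m ! Suc h < card (Ns ! Suc h)" if h: "Suc h < length Ns" for h
  proof -
    have hl: "h < length Ns" using h by simp
    obtain i j where i: "i \<in> Ns ! h" and j: "j \<in> Ns ! Suc h"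
      using pos[OF hl] pos[OF h] by (metis card_gt_0_iff all_not_in_conv)
    have "\<not> desirable N W j i"
      using class_chain_strict[OF chain lessI h i j] by (simp add: strictly_desirable_def)
    then obtain S where S: "S \<subseteq> N - {j, i}" "insert i S \<in> W" "insert j S \<notin> W"
      by (auto simp: desirable_def)
    have ij: "i \<notin> S" "j \<notin> S" using S by auto
    note ci = card_exchange_upper(1)[OF i hl j h ij] and cj = card_exchange_upper(2)[OF i hl j h ij]
    let ?M = "\<lambda>k. sum_list (take k m)"
    have all: "?M k \<le> card (S \<inter> upper Ns k) + of_bool (h < k)" if "k \<le> length Ns" for k
      using S(2) ci that unfolding W mem_vector_game by fastforce
    have "insert j S \<subseteq> N" using S j block_subset[OF h] by auto
    then obtain k where k: "k \<le> length Ns" "card (S \<inter> upper Ns k) + of_bool (Suc h < k) < ?M k"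
      using S(3) cj len unfolding W mem_vector_game by fastforce
    \<comment> \<open>\<open>insert i S\<close> and \<open>insert j S\<close> have different counts
      on this prefix only, so it is the one where the losing coalition falls short.\<close>
    then have "k = Suc h" using all[OF k(1)] by (cases "h < k"; cases "Suc h < k") auto
    then have eq: "card (S \<inter> upper Ns (Suc h)) < ?M (Suc h)" using k by simp
    have "?M h \<le> card (S \<inter> upper Ns h)" using all[of h] h by simp
    moreover have "?M (Suc (Suc h)) \<le> card (S \<inter> upper Ns (Suc (Suc h))) + 1"
      using all[of "Suc (Suc h)"] h by simp
    moreover have "card (S \<inter> Ns ! Suc h) < card (Ns ! Suc h)"
      using ij j finite_block[OF h] by (intro psubset_card_mono) auto
    ultimately show ?thesis
      using eq h len by (simp add: sum_list_take_Suc card_inter_upper_Suc)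
  qed
  have "0 < m ! 0"
  proof (rule ccontr)
    assume "\<not> 0 < m ! 0"
    then have m0: "m ! 0 = 0" by simp
    \<comment> \<open>A second class would force a positive first entry by
      \<open>step\<close>.\<close>
    then have "length Ns = 1" using step[of 0] ne by (cases Ns; cases "tl Ns") auto
    then obtain x where "m = [x]" using len by (cases m) auto
    then have "m = [0]" using m0 by simp
    then have "{} \<in> W" unfolding W mem_vector_game using \<open>length Ns = 1\<close>
      by (auto simp: take_Cons')
    then show False using emp by simp
  qed
  then show ?thesis using len le ne step pos by (auto simp: admissible_def)
qed

context ordered_partition
begin

text \<open>Exchanging for a player of the same or an earlier block never lowers a prefix count,
  which gives desirability along the chain. Strictness is witnessed by a coalition of profile
  \<open>m\<close> itself: it meets every prefix bound with equality, so replacing \<open>i\<close>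
  by a player \<open>j\<close> of a later block violates the bound at the block of
  \<open>i\<close>.\<close>

lemma admissible_vector_game:
  assumes "admissible (map card Ns) m"
  shows "class_chain N (vector_game N Ns m) Ns" and "simple_game N (vector_game N Ns m)"
proof -
  let ?W = "vector_game N Ns m"
  have len: "length m = length Ns" and ne: "Ns \<noteq> []" and m0: "0 < m ! 0"
    and le: "\<And>h. h < length Ns \<Longrightarrow> m ! h \<le> card (Ns ! h)"
    and step: "\<And>h. Suc h < length Ns \<Longrightarrow> 0 < m ! h \<and> m ! Suc h < card (Ns ! Suc h)"
    using assms by (auto simp: admissible_def)
  have des: "desirable N ?W i j"
    if "a \<le> b" "b < length Ns" "i \<in> Ns ! a" "j \<in> Ns ! b" for a b i j
    unfolding desirable_def
  proof (intro allI impI)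
    fix S assume S: "S \<subseteq> N - {i, j}" "S \<union> {j} \<in> ?W"
    have a: "a < length Ns" using that by simp
    have ij: "i \<notin> S" "j \<notin> S" using S by auto
    have "card (insert j S \<inter> upper Ns k) \<le> card (insert i S \<inter> upper Ns k)" if "k \<le> length Ns" for k
      unfolding card_exchange_upper(1)[OF \<open>i \<in> _\<close> a \<open>j \<in> _\<close> \<open>b < _\<close> ij that]
        card_exchange_upper(2)[OF \<open>i \<in> _\<close> a \<open>j \<in> _\<close> \<open>b < _\<close> ij that] using \<open>a \<le> b\<close> by simp
    moreover have "insert i S \<subseteq> N" using S that block_subset[OF a] by auto
    ultimately show "S \<union> {i} \<in> ?W" using S(2) unfolding mem_vector_game
      by (auto intro: le_trans)
  qed
  have ndes: "\<not> desirable N ?W j i"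
    if ab: "a < b" "b < length Ns" and ij: "i \<in> Ns ! a" "j \<in> Ns ! b" for a b i j
  proof
    assume D: "desirable N ?W j i"
    have a: "a < length Ns" using ab by simp
    have N: "i \<in> N" "j \<in> N" using ij block_subset a ab by blast+
    have neq: "i \<noteq> j" using block_unique[OF a ab(2)] ij ab by blast
    have "card ({i} \<inter> Ns ! h) \<le> m ! h \<and> m ! h \<le> card (Ns ! h - {j})" if h: "h < length Ns" for h
    proof
      show "card ({i} \<inter> Ns ! h) \<le> m ! h"
      proof (cases "h = a")
        case True
        then show ?thesis using step[of a] ab card_mono[of "{i}" "{i} \<inter> Ns ! h"] by auto
      next
        case False
        then have "{i} \<inter> Ns ! h = {}" using block_unique[OF a h] ij by auto
        then show ?thesis by simp
      qed
      show "m ! h \<le> card (Ns ! h - {j})"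
      proof (cases "h = b")
        case True
        then have "m ! h < card (Ns ! h)" using step[of "b - 1"] ab by simp
        then show ?thesis using True ij by (simp add: card_Diff_singleton)
      next
        case False
        then have "Ns ! h - {j} = Ns ! h" using block_unique[OF ab(2) h] ij by auto
        then show ?thesis using le[OF h] by simp
      qed
    qed
    then obtain T where T: "T \<subseteq> N" "{i} \<subseteq> T" "T \<inter> {j} = {}" "profile Ns T = m"
      using coalition_with_profile[of m "{i}" "{j}"] len N neq by auto
    define S where "S = T - {i}"
    have S: "i \<notin> S" "j \<notin> S" "T = insert i S" using T by (auto simp: S_def)
    have "T \<in> ?W" using profile_in_vector_game T by blast
    moreover have "S \<subseteq> N - {j, i}" using T S by auto
    ultimately have "insert j S \<in> ?W" using D S(3) by (auto simp: desirable_def)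
    then have "sum_list (take (Suc a) m) \<le> card (insert j S \<inter> upper Ns (Suc a))"
      using a unfolding mem_vector_game by auto
    also have "\<dots> < card (T \<inter> upper Ns (Suc a))"
      unfolding S(3) using card_exchange_upper[OF ij(1) a ij(2) ab(2) S(1,2), of "Suc a"] ab a
      by simp
    also have "\<dots> = sum_list (take (Suc a) m)"
      using card_inter_upper_profile[OF T(4)] a by simp
    finally show False by simp
  qed
  have cls: "desir_equiv N ?W `` {i} = Ns ! a" if a: "a < length Ns" "i \<in> Ns ! a" for a i
  proof
    show "Ns ! a \<subseteq> desir_equiv N ?W `` {i}"
      using des[of a a] a block_subset[OF a(1)] by (auto simp: desir_equiv_def)
    show "desir_equiv N ?W `` {i} \<subseteq> Ns ! a"
    proof
      fix j assume "j \<in> desir_equiv N ?W `` {i}"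
      then have j: "j \<in> N" "desirable N ?W i j" "desirable N ?W j i"
        by (auto simp: desir_equiv_def)
      then obtain b where b: "b < length Ns" "j \<in> Ns ! b" using block_mem by blast
      then have "a = b" using ndes[of a b i j] ndes[of b a j i] a j by (meson nat_neq_iff)
      then show "j \<in> Ns ! a" using b by simp
    qed
  qed
  have "set Ns = N // desir_equiv N ?W"
  proof
    show "set Ns \<subseteq> N // desir_equiv N ?W"
    proof
      fix A assume A: "A \<in> set Ns"
      then obtain a where a: "a < length Ns" "A = Ns ! a" by (auto simp: in_set_conv_nth)
      obtain i where i: "i \<in> A" using block_nonempty[OF A] by blast
      then have "i \<in> N" using block_subset a by blast
      moreover have "A = desir_equiv N ?W `` {i}" using cls a i by simp
      ultimately show "A \<in> N // desir_equiv N ?W" by (auto simp: quotient_def)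
    qed
    show "N // desir_equiv N ?W \<subseteq> set Ns"
    proof
      fix A assume "A \<in> N // desir_equiv N ?W"
      then obtain i where i: "i \<in> N" "A = desir_equiv N ?W `` {i}" by (auto simp: quotient_def)
      then obtain a where "a < length Ns" "i \<in> Ns ! a" using block_mem by blast
      then show "A \<in> set Ns" using cls i by simp
    qed
  qed
  moreover have "sorted_wrt (\<lambda>A B. \<forall>i\<in>A. \<forall>j\<in>B. strictly_desirable N ?W i j) Ns"
    unfolding sorted_wrt_iff_nth_less strictly_desirable_def
    using des ndes by (meson less_imp_le)
  ultimately show "class_chain N ?W Ns" by (simp add: class_chain_def)
  obtain T where T: "T \<subseteq> N" "profile Ns T = m" using game_vector_profile len le by blast
  have up: "S' \<in> ?W" if "S \<in> ?W" "S \<subseteq> S'" "S' \<subseteq> N" for S S'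
  proof -
    have "card (S \<inter> upper Ns k) \<le> card (S' \<inter> upper Ns k)" for k
      using that finite_inter_upper by (intro card_mono) auto
    then show ?thesis using that unfolding mem_vector_game by (meson le_trans)
  qed
  moreover have "N \<in> ?W" using up[OF profile_in_vector_game[OF T]] T by simp
  moreover have "{} \<notin> ?W"
  proof
    assume "{} \<in> ?W"
    moreover have "1 \<le> length Ns" using ne by (simp add: Suc_le_eq)
    ultimately have "sum_list (take 1 m) \<le> card ({} \<inter> upper Ns 1)"
      unfolding mem_vector_game by blast
    then show False using m0 len ne by (cases m) auto
  qed
  ultimately show "simple_game N ?W"
    unfolding simple_game_def by (auto simp: mem_vector_game)
qed

end

subsection \<open>Weightedness\<close>

text \<open>Players in a class \<open>h\<close> outside the core are all veto players or all null players.\<close>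

definition core :: "nat list \<Rightarrow> nat list \<Rightarrow> nat \<Rightarrow> bool" where
  "core ns m h \<longleftrightarrow> h < length ns \<and> 0 < m ! h \<and> m ! h < ns ! h"

text \<open>The numerical criterion for weights: necessary by \<open>weighted_imp_tame\<close>, and
  for admissible pairs sufficient by \<open>game_params_vector_weighted\<close>. The condition falls
  on the later class \<open>b\<close>, since the trade needs two players inside and two outside the
  coalition there, but only one of each in \<open>a\<close>.\<close>

definition tame :: "nat list \<Rightarrow> nat list \<Rightarrow> bool" where
  "tame ns m \<longleftrightarrow>
     (\<forall>a b c. a < b \<and> b < c \<longrightarrow> \<not> (core ns m a \<and> core ns m b \<and> core ns m c)) \<and>
     (\<forall>a b. a < b \<and> core ns m a \<and> core ns m b \<longrightarrow> m ! b = 1 \<or> Suc (m ! b) = ns ! b)"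

context ordered_partition
begin

text \<open>
  Obstruction to weights: with \<open>A = T - insert i P\<close>, the winning coalitions \<open>T = A \<union> {i} \<union> P\<close> and \<open>A \<union> {j} \<union> Q\<close> have
  the same total weight as \<open>A \<union> P \<union> Q\<close>, which has too few players in the classes up to \<open>a\<close>, and
  \<open>A \<union> {i, j}\<close>, which has too few players altogether.
\<close>

lemma no_trade:
  assumes W: "weighted_game N (vector_game N Ns m)"
    and T: "T \<subseteq> N" "profile Ns T = m"
    and a: "a < length Ns" and i: "i \<in> Ns ! a" "i \<in> T" and j: "j \<in> Ns ! a" "j \<notin> T"
    and P: "P \<subseteq> T" "card P = 2" and Q: "Q \<subseteq> N - T"
    and PQ: "\<And>k. k \<le> length Ns \<Longrightarrow> card (P \<inter> upper Ns k) = card (Q \<inter> upper Ns k)"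
    and low: "P \<inter> upper Ns (Suc a) = {}" "Q \<inter> upper Ns (Suc a) = {}"
  shows False
proof -
  let ?W = "vector_game N Ns m"
  obtain w :: "'a \<Rightarrow> real" and q where w:
    "\<And>S. S \<subseteq> N \<Longrightarrow> S \<in> ?W \<longleftrightarrow> q \<le> (\<Sum>i\<in>S. w i)"
    using W unfolding weighted_game_def by blast
  have up: "i \<in> upper Ns (Suc a)" "j \<in> upper Ns (Suc a)" using i j a by (auto simp: upper_Suc)
  have iP: "i \<notin> P" and jQ: "j \<notin> Q" using up low by auto
  have N: "i \<in> N" "j \<in> N" using i j block_subset[OF a] by auto
  define A where "A = T - insert i P"
  have fin: "finite T" "finite P" "finite Q" "finite A"
    using T P Q finite_players by (auto simp: A_def intro: finite_subset)
  have T_eq: "T = A \<union> insert i P" using i P by (auto simp: A_def)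
  define X where "X = A \<union> (P \<union> Q)"
  define Y where "Y = A \<union> {i, j}"
  define T' where "T' = A \<union> insert j Q"
  have sub: "X \<subseteq> N" "Y \<subseteq> N" "T' \<subseteq> N" using T P Q N by (auto simp: A_def X_def Y_def T'_def)
  have disj: "A \<inter> insert i P = {}" "A \<inter> (P \<union> Q) = {}" "P \<inter> Q = {}" "A \<inter> {i, j} = {}"
    "A \<inter> insert j Q = {}" "i \<noteq> j" using P Q i j by (auto simp: A_def)
  have "sum w T = sum w A + (w i + sum w P)"
    unfolding T_eq using disj fin iP by (simp add: sum.union_disjoint)
  moreover have "sum w X = sum w A + (sum w P + sum w Q)"
    unfolding X_def using disj fin by (simp add: sum.union_disjoint)
  moreover have "sum w Y = sum w A + (w i + w j)"
    unfolding Y_def using disj fin by (simp add: sum.union_disjoint)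
  moreover have "sum w T' = sum w A + (w j + sum w Q)"
    unfolding T'_def using disj fin jQ by (simp add: sum.union_disjoint)
  ultimately have sums: "sum w T + sum w T' = sum w X + sum w Y" by simp
  have cT: "card (T \<inter> upper Ns k) = sum_list (take k m)" if "k \<le> length Ns" for k
    using card_inter_upper_profile[OF T(2) that] .
  have "T \<in> ?W" using profile_in_vector_game T by blast
  moreover have "T' \<in> ?W"
  proof -
    have "card (T' \<inter> upper Ns k) = card (T \<inter> upper Ns k)" if k: "k \<le> length Ns" for k
    proof -
      have ex: "card (insert i P \<inter> upper Ns k) = card (insert j Q \<inter> upper Ns k)"
        using PQ[OF k] mem_upper[OF a i(1) k] mem_upper[OF a j(1) k] iP jQ fin
        by (simp add: Int_insert_left)
      have "card (T' \<inter> upper Ns k) = card (A \<inter> upper Ns k) + card (insert j Q \<inter> upper Ns k)"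
        unfolding T'_def Int_Un_distrib2 using disj fin by (intro card_Un_disjoint) auto
      moreover have "card (T \<inter> upper Ns k) = card (A \<inter> upper Ns k) + card (insert i P \<inter> upper Ns k)"
        unfolding T_eq Int_Un_distrib2 using disj fin by (intro card_Un_disjoint) auto
      ultimately show ?thesis using ex by simp
    qed
    then show ?thesis using sub cT length_profile[of Ns T] T(2) by (auto simp: mem_vector_game)
  qed
  moreover have "X \<notin> ?W"
  proof
    assume "X \<in> ?W"
    then have "sum_list (take (Suc a) m) \<le> card (X \<inter> upper Ns (Suc a))"
      using a by (auto simp: mem_vector_game)
    moreover have "X \<inter> upper Ns (Suc a) \<subset> T \<inter> upper Ns (Suc a)"
      using low up i by (auto simp: X_def A_def)
    then have "card (X \<inter> upper Ns (Suc a)) < card (T \<inter> upper Ns (Suc a))"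
      using finite_inter_upper by (intro psubset_card_mono)
    ultimately show False using cT[of "Suc a"] a by simp
  qed
  moreover have "Y \<notin> ?W"
  proof
    assume "Y \<in> ?W"
    then have "sum_list (take (length Ns) m) \<le> card (Y \<inter> upper Ns (length Ns))"
      unfolding mem_vector_game by blast
    then have "card T \<le> card Y" using cT[of "length Ns"] sub T by (simp add: Int_absorb2)
    moreover have "card Y = card A + 2"
      unfolding Y_def using disj fin by (simp add: card_Un_disjoint)
    moreover have "card T = card A + 3"
      unfolding T_eq using disj fin iP P by (simp add: card_Un_disjoint)
    ultimately show False by simp
  qed
  ultimately show False using w sub T sums by fastforce
qed

text \<open>Both conditions come from \<open>no_trade\<close> with \<open>i\<close> and
  \<open>j\<close> in class \<open>a\<close>. For three core classes, \<open>P\<close> and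
  \<open>Q\<close> take one player each from \<open>b\<close> and from \<open>c\<close>; for two
  core classes, both take two players from \<open>b\<close>.\<close>

lemma weighted_imp_tame:
  assumes W: "weighted_game N (vector_game N Ns m)"
    and m: "length m = length Ns" "\<And>h. h < length Ns \<Longrightarrow> m ! h \<le> card (Ns ! h)"
  shows "tame (map card Ns) m"
proof -
  obtain T where T: "T \<subseteq> N" "profile Ns T = m" using game_vector_profile m by blast
  have inT: "card (T \<inter> Ns ! h) = m ! h" if "h < length Ns" for h
    using T(2) that nth_profile by metis
  have outT: "card (Ns ! h - T) = card (Ns ! h) - m ! h" if "h < length Ns" for h
    using inT[OF that] finite_block[OF that] by (simp add: card_Diff_subset_Int Int_commute)
  have ex: "\<exists>i j. i \<in> Ns ! h \<and> i \<in> T \<and> j \<in> Ns ! h \<and> j \<notin> T" if "core (map card Ns) m h" for h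
  proof -
    have h: "h < length Ns" "0 < m ! h" "m ! h < card (Ns ! h)"
      using that by (auto simp: core_def)
    then have "T \<inter> Ns ! h \<noteq> {}" "Ns ! h - T \<noteq> {}"
      using inT[OF h(1)] outT[OF h(1)] by (metis card.empty less_irrefl zero_less_diff)+
    then show ?thesis by blast
  qed
  have len: "core (map card Ns) m h \<Longrightarrow> h < length Ns" for h by (simp add: core_def)
  have "\<not> (core (map card Ns) m a \<and> core (map card Ns) m b \<and> core (map card Ns) m c)"
    if "a < b" "b < c" for a b c
  proof
    assume *: "core (map card Ns) m a \<and> core (map card Ns) m b \<and> core (map card Ns) m c"
    then have l: "a < length Ns" "b < length Ns" "c < length Ns" using len by auto
    obtain i j where ij: "i \<in> Ns ! a" "i \<in> T" "j \<in> Ns ! a" "j \<notin> T" using ex * by blast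
    obtain p q where pq: "p \<in> Ns ! b" "p \<in> T" "q \<in> Ns ! b" "q \<notin> T" using ex * by blast
    obtain p' q' where pq': "p' \<in> Ns ! c" "p' \<in> T" "q' \<in> Ns ! c" "q' \<notin> T" using ex * by blast
    have neq: "p \<noteq> p'" "q \<noteq> q'" using block_unique[OF l(2,3)] pq pq' that by auto
    show False
    proof (rule no_trade[OF W T l(1) ij, of "{p, p'}" "{q, q'}"])
      show "{q, q'} \<subseteq> N - T" using pq pq' block_subset l by auto
      show "card ({p, p'} \<inter> upper Ns k) = card ({q, q'} \<inter> upper Ns k)" if k: "k \<le> length Ns" for k
        using mem_upper[OF l(2) pq(1) k] mem_upper[OF l(2) pq(3) k]
          mem_upper[OF l(3) pq'(1) k] mem_upper[OF l(3) pq'(3) k] neq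
        by (auto simp: Int_insert_left)
      have k: "Suc a \<le> length Ns" using l by simp
      show "{p, p'} \<inter> upper Ns (Suc a) = {}" "{q, q'} \<inter> upper Ns (Suc a) = {}"
        using mem_upper[OF l(2) pq(1) k] mem_upper[OF l(2) pq(3) k]
          mem_upper[OF l(3) pq'(1) k] mem_upper[OF l(3) pq'(3) k] that by auto
    qed (use pq pq' neq in auto)
  qed
  moreover have "m ! b = 1 \<or> Suc (m ! b) = map card Ns ! b"
    if "a < b" and c: "core (map card Ns) m a" "core (map card Ns) m b" for a b
  proof (rule ccontr)
    assume n: "\<not> ?thesis"
    have l: "a < length Ns" "b < length Ns" using len c by auto
    have two: "2 \<le> m ! b" "2 \<le> card (Ns ! b) - m ! b"
      using c(2) n l by (auto simp: core_def)
    obtain i j where ij: "i \<in> Ns ! a" "i \<in> T" "j \<in> Ns ! a" "j \<notin> T" using ex c by blast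
    obtain P where P: "P \<subseteq> T \<inter> Ns ! b" "card P = 2" "finite P"
      using obtain_subset_with_card_n[of 2 "T \<inter> Ns ! b"] two inT[OF l(2)] by auto
    obtain Q where Q: "Q \<subseteq> Ns ! b - T" "card Q = 2" "finite Q"
      using obtain_subset_with_card_n[of 2 "Ns ! b - T"] two outT[OF l(2)] by auto
    have inter: "R \<inter> upper Ns k = (if b < k then R else {})"
      if "R \<subseteq> Ns ! b" "k \<le> length Ns" for R k
      using mem_upper[OF l(2) _ that(2)] that(1) by auto
    have R: "P \<subseteq> Ns ! b" "Q \<subseteq> Ns ! b" using P Q by auto
    show False
    proof (rule no_trade[OF W T l(1) ij, of P Q])
      show "Q \<subseteq> N - T" using Q block_subset[OF l(2)] by auto
      show "card (P \<inter> upper Ns k) = card (Q \<inter> upper Ns k)" if "k \<le> length Ns" for k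
        using inter[OF R(1) that] inter[OF R(2) that] P Q by simp
      show "P \<inter> upper Ns (Suc a) = {}" "Q \<inter> upper Ns (Suc a) = {}"
        using inter[OF R(1), of "Suc a"] inter[OF R(2), of "Suc a"] that l by auto
    qed (use P in auto)
  qed
  ultimately show ?thesis unfolding tame_def by blast
qed

end

section \<open>Explicit weights\<close>

text \<open>One weight per class turns weightedness into a statement about number lists. In this
  form it can be carried over when a class is put in front or at the end.\<close>

definition vector_weighted :: "nat list \<Rightarrow> nat list \<Rightarrow> bool" where
  "vector_weighted ns m \<longleftrightarrow> (\<exists>(v :: real list) q. length v = length ns \<and> (\<forall>x\<in>set v. 0 \<le> x) \<and> 0 < q \<and>
     (\<forall>x. list_all2 (\<le>) x ns \<longrightarrow>
       (dominates x m \<longleftrightarrow> q \<le> sum_list (map2 (\<lambda>a b. a * real b) v x))))"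

lemma all_le_Suc_iff: "(\<forall>k\<le>Suc n. P k) \<longleftrightarrow> P 0 \<and> (\<forall>k\<le>n. P (Suc k))"
  by (metis Suc_le_mono le0 not0_implies_Suc)

lemma dominates_singleton: "dominates [x] [m] \<longleftrightarrow> m \<le> x"
  by (auto simp: dominates_def all_le_Suc_iff)

lemma dominates_pair: "dominates [x, y] [m, k] \<longleftrightarrow> m \<le> x \<and> m + k \<le> x + y"
  by (auto simp: dominates_def all_le_Suc_iff)

text \<open>The first prefix condition forces \<open>x = n\<close>, and \<open>n\<close> then
  cancels from all longer prefixes.\<close>

lemma dominates_veto:
  assumes "x \<le> n"
  shows "dominates (x # xs) (n # m) \<longleftrightarrow> x = n \<and> dominates xs m"
proof
  assume d: "dominates (x # xs) (n # m)"
  then have len: "length xs = length m"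
    and le: "\<And>k. k \<le> length xs \<Longrightarrow> n + sum_list (take k m) \<le> x + sum_list (take k xs)"
    by (auto simp: dominates_def all_le_Suc_iff)
  have "x = n" using le[of 0] assms by simp
  then show "x = n \<and> dominates xs m" using len le by (auto simp: dominates_def)
qed (auto simp: dominates_def all_le_Suc_iff)

text \<open>Only the full prefix is new, and its bound is that of the preceding prefix because the
  added entry is \<open>0\<close>.\<close>

lemma dominates_null: "dominates (xs @ [x]) (m @ [0]) \<longleftrightarrow> dominates xs m"
proof
  assume d: "dominates (xs @ [x]) (m @ [0])"
  then have len: "length xs = length m" by (simp add: dominates_def)
  have "sum_list (take k m) \<le> sum_list (take k xs)" if "k \<le> length xs" for k
  proof -
    have "sum_list (take k (m @ [0])) \<le> sum_list (take k (xs @ [x]))"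
      using d that unfolding dominates_def by (metis le_SucI length_append_singleton)
    then show ?thesis using that len by simp
  qed
  then show "dominates xs m" using len by (simp add: dominates_def)
next
  assume d: "dominates xs m"
  then have len: "length xs = length m" by (simp add: dominates_def)
  have "sum_list (take k (m @ [0])) \<le> sum_list (take k (xs @ [x]))" if "k \<le> Suc (length xs)" for k
  proof (cases "k \<le> length xs")
    case True
    then show ?thesis using d len by (simp add: dominates_def)
  next
    case False
    then have "k = Suc (length xs)" using that by simp
    moreover have "sum_list (take (length xs) m) \<le> sum_list (take (length xs) xs)"
      using d unfolding dominates_def by blast
    ultimately show ?thesis using len by simp
  qed
  then show "dominates (xs @ [x]) (m @ [0])" using len by (simp add: dominates_def)
qed

lemma weighted_sum_mono:
  assumes "list_all2 (\<le>) x y" "length v = length y" "\<forall>a\<in>set v. 0 \<le> a"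
  shows "sum_list (map2 (\<lambda>a b. a * real b) v x) \<le> sum_list (map2 (\<lambda>a b. a * real b) v y)"
  using assms
proof (induction arbitrary: v rule: list_all2_induct)
  case (Cons x xs y ys)
  then obtain a v' where v: "v = a # v'" by (cases v) auto
  have "a * real x \<le> a * real y" using Cons v by (auto intro: mult_left_mono)
  then show ?case using Cons v by (auto intro!: add_mono)
qed simp

lemma vector_weighted_veto:
  assumes "vector_weighted ns m"
  shows "vector_weighted (n # ns) (n # m)"
proof -
  let ?s = "\<lambda>v x. sum_list (map2 (\<lambda>a b. a * real b) v x)"
  obtain v :: "real list" and q where v: "length v = length ns" "\<forall>x\<in>set v. 0 \<le> x" "0 < q"
    and dom: "\<And>x. list_all2 (\<le>) x ns \<Longrightarrow> dominates x m \<longleftrightarrow> q \<le> ?s v x"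
    using assms unfolding vector_weighted_def by blast
  \<comment> \<open>A veto player gets the total weight of all other classes. Missing one costs
    \<open>V\<close>, the other classes contribute at most \<open>V\<close>, and the positive
    \<open>q\<close> in the quota \<open>n * V + q\<close> keeps such coalitions losing.\<close>
  define V where "V = ?s v ns"
  have V: "0 \<le> V" unfolding V_def using v(2) by (auto intro!: sum_list_nonneg mult_nonneg_nonneg simp: set_zip)
  have "dominates x (n # m) \<longleftrightarrow> real n * V + q \<le> ?s (V # v) x"
    if x: "list_all2 (\<le>) x (n # ns)" for x
  proof -
    obtain y xs where x: "x = y # xs" "y \<le> n" "list_all2 (\<le>) xs ns"
      using x by (cases x) auto
    have le: "?s v xs \<le> V" unfolding V_def using weighted_sum_mono x v by blast
    show ?thesis
    proof (cases "y = n")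
      case True
      then show ?thesis using x dom by (simp add: dominates_veto mult.commute)
    next
      case False
      then have "real y + 1 \<le> real n" using x by simp
      then have "(real y + 1) * V \<le> real n * V" using V by (rule mult_right_mono)
      then have "V * real y + ?s v xs < real n * V + q"
        using le v(3) by (simp add: algebra_simps)
      then show ?thesis using False x by (simp add: dominates_veto)
    qed
  qed
  then show ?thesis
    unfolding vector_weighted_def using v V
    by (intro exI[of _ "V # v"] exI[of _ "real n * V + q"]) (simp add: add_nonneg_pos)
qed

lemma vector_weighted_null:
  assumes "vector_weighted ns m"
  shows "vector_weighted (ns @ [n]) (m @ [0])"
proof -
  let ?s = "\<lambda>v x. sum_list (map2 (\<lambda>a b. a * real b) v x)"
  obtain v :: "real list" and q where v: "length v = length ns" "\<forall>x\<in>set v. 0 \<le> x" "0 < q"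
    and dom: "\<And>x. list_all2 (\<le>) x ns \<Longrightarrow> dominates x m \<longleftrightarrow> q \<le> ?s v x"
    using assms unfolding vector_weighted_def by blast
  have "dominates x (m @ [0]) \<longleftrightarrow> q \<le> ?s (v @ [0]) x" if x: "list_all2 (\<le>) x (ns @ [n])" for x
  proof -
    obtain xs y where x: "x = xs @ [y]" "list_all2 (\<le>) xs ns"
      using x unfolding list_all2_append2 list_all2_Cons2 by auto
    then show ?thesis using dom v list_all2_lengthD[OF x(2)] by (simp add: dominates_null)
  qed
  then show ?thesis
    unfolding vector_weighted_def using v
    by (intro exI[of _ "v @ [0]"] exI[of _ q]) auto
qed

lemma vector_weighted_singleton:
  assumes "0 < m"
  shows "vector_weighted [n] [m]"
  unfolding vector_weighted_def using assms
  by (intro exI[of _ "[1]"] exI[of _ "real m"])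
    (auto simp: list_all2_Cons2 dominates_singleton)

text \<open>Winning means \<open>x > m\<close>, or \<open>x = m\<close> and
  \<open>y \<ge> 1\<close>. As \<open>y \<le> n'\<close>, the factor \<open>n'\<close> on
  \<open>x\<close> makes the first coordinate decisive: for \<open>x < m\<close> the weight is at
  most \<open>m * n'\<close>, just below the quota, and for \<open>x > m\<close> the first
  coordinate alone reaches it.\<close>

lemma vector_weighted_pair_one:
  assumes "0 < n'"
  shows "vector_weighted [n, n'] [m, 1]"
proof -
  have "m \<le> x \<and> m + 1 \<le> x + y \<longleftrightarrow> m * n' + 1 \<le> n' * x + y" if y: "y \<le> n'" for x y
  proof -
    consider "x < m" | "x = m" | "m < x" by linarith
    then show ?thesis
    proof cases
      case 1
      then have "Suc x * n' \<le> m * n'" by (intro mult_right_mono) auto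
      then show ?thesis using 1 y by (simp add: algebra_simps)
    next
      case 2
      then show ?thesis by (simp add: mult.commute)
    next
      case 3
      then have "Suc m * n' \<le> x * n'" by (intro mult_right_mono) auto
      then show ?thesis using 3 assms by (simp add: algebra_simps)
    qed
  qed
  then have "m \<le> x \<and> m + 1 \<le> x + y \<longleftrightarrow> real (m * n' + 1) \<le> real (n' * x + y)" if "y \<le> n'" for x y
    using that of_nat_le_iff by blast
  then show ?thesis
    unfolding vector_weighted_def
    by (intro exI[of _ "[real n', 1]"] exI[of _ "real (m * n' + 1)"])
      (auto simp: list_all2_Cons2 dominates_pair add_pos_nonneg)
qed

lemma vector_weighted_pair_all_but_one:
  assumes "0 < m" "m \<le> n"
  shows "vector_weighted [n, Suc k] [m, k]"
proof -
  have "m \<le> x \<and> m + k \<le> x + y \<longleftrightarrow> m * (n + 2) + k * (n + 1) \<le> (n + 2) * x + (n + 1) * y"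
    if x: "x \<le> n" and y: "y \<le> Suc k" for x y
  proof -
    \<comment> \<open>With weights \<open>n + 2\<close> and \<open>n + 1\<close> the total reads as
      the number \<open>x + y\<close> in units of \<open>n + 1\<close>, plus the remainder
      \<open>x \<le> n\<close>. A surplus in \<open>x + y\<close> guarantees
      \<open>m \<le> x\<close>, because \<open>y\<close> is at most \<open>Suc k\<close>; a tie is
      decided by \<open>x\<close>.\<close>
    have eq: "m * (n + 2) + k * (n + 1) = (m + k) * (n + 1) + m"
      "(n + 2) * x + (n + 1) * y = (x + y) * (n + 1) + x" by (simp_all add: algebra_simps)
    consider "x + y < m + k" | "x + y = m + k" | "m + k < x + y" by linarith
    then show ?thesis
    proof cases
      case 1
      then have "Suc (x + y) * (n + 1) \<le> (m + k) * (n + 1)" by (intro mult_right_mono) auto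
      then have "(x + y) * (n + 1) + (n + 1) \<le> (m + k) * (n + 1)" by simp
      then show ?thesis unfolding eq using 1 x assms by linarith
    next
      case 2
      then show ?thesis unfolding eq by simp
    next
      case 3
      then have "Suc (m + k) * (n + 1) \<le> (x + y) * (n + 1)" by (intro mult_right_mono) auto
      then have "(m + k) * (n + 1) + (n + 1) \<le> (x + y) * (n + 1)" by simp
      then show ?thesis unfolding eq using 3 y assms by linarith
    qed
  qed
  then have "m \<le> x \<and> m + k \<le> x + y \<longleftrightarrow>
      real (m * (n + 2) + k * (n + 1)) \<le> real ((n + 2) * x + (n + 1) * y)"
    if "x \<le> n" "y \<le> Suc k" for x y
    using that of_nat_le_iff by blast
  moreover have "0 < real (m * (n + 2) + k * (n + 1))" using assms by (simp only: of_nat_0_less_iff) simp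
  ultimately show ?thesis
    unfolding vector_weighted_def
    by (intro exI[of _ "[real (n + 2), real (n + 1)]"] exI[of _ "real (m * (n + 2) + k * (n + 1))"])
      (auto simp: list_all2_Cons2 dominates_pair algebra_simps)
qed

context ordered_partition
begin

lemma vector_weighted_game:
  assumes "vector_weighted (map card Ns) m" "simple_game N (vector_game N Ns m)"
  shows "weighted_game N (vector_game N Ns m)"
proof -
  let ?s = "\<lambda>v x. sum_list (map2 (\<lambda>a b. a * real b) v x)"
  obtain v :: "real list" and q where v: "length v = length Ns" "\<forall>x\<in>set v. 0 \<le> x" "0 < q"
    and dom: "\<And>x. list_all2 (\<le>) x (map card Ns) \<Longrightarrow> dominates x m \<longleftrightarrow> q \<le> ?s v x"
    using assms(1) unfolding vector_weighted_def length_map by blast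
  \<comment> \<open>For a player only the summand of its own block contributes; writing the weight
    as a sum allows the order of summation to be exchanged below.\<close>
  define w where "w i = (\<Sum>h<length Ns. if i \<in> Ns ! h then v ! h else 0)" for i
  have "0 \<le> w i" for i unfolding w_def using v by (auto intro!: sum_nonneg)
  moreover have "S \<in> vector_game N Ns m \<longleftrightarrow> q \<le> (\<Sum>i\<in>S. w i)" if S: "S \<subseteq> N" for S
  proof -
    have fin: "finite S" using S finite_players finite_subset by blast
    have "(\<Sum>i\<in>S. w i) = (\<Sum>h<length Ns. \<Sum>i\<in>S. if i \<in> Ns ! h then v ! h else 0)"
      unfolding w_def by (rule sum.swap)
    also have "\<dots> = (\<Sum>h<length Ns. v ! h * real (card (S \<inter> Ns ! h)))"
      using fin by (simp add: sum.inter_restrict[symmetric] mult.commute)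
    also have "\<dots> = ?s v (profile Ns S)"
      using v(1) by (simp add: sum_list_sum_nth atLeast0LessThan)
    finally have "(\<Sum>i\<in>S. w i) = ?s v (profile Ns S)" .
    moreover have "list_all2 (\<le>) (profile Ns S) (map card Ns)"
      using finite_block by (auto simp: list_all2_conv_all_nth intro: card_mono)
    ultimately show ?thesis using dom S by (simp add: vector_game_def)
  qed
  ultimately show ?thesis unfolding weighted_game_def using assms(2) v(3) by blast
qed

section \<open>Veto and null players\<close>

lemma nontrivial_vector_game:
  assumes adm: "admissible (map card Ns) m"
  shows "nontrivial_game N (vector_game N Ns m) \<longleftrightarrow>
    m ! 0 < map card Ns ! 0 \<and> 0 < m ! (length m - 1)"
proof -
  let ?W = "vector_game N Ns m" and ?l = "length Ns - 1"
  have len: "length m = length Ns" and ne: "Ns \<noteq> []" and m0: "0 < m ! 0"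
    and le: "\<And>h. h < length Ns \<Longrightarrow> m ! h \<le> card (Ns ! h)"
    and step: "\<And>h. Suc h < length Ns \<Longrightarrow> 0 < m ! h \<and> m ! Suc h < card (Ns ! Suc h)"
    using adm by (auto simp: admissible_def)
  have l0: "0 < length Ns" and ll: "?l < length Ns" using ne by auto
  show ?thesis
  proof
    assume nt: "nontrivial_game N ?W"
    have "m ! 0 < card (Ns ! 0)"
    proof (rule ccontr)
      assume "\<not> ?thesis"
      then have eq: "m ! 0 = card (Ns ! 0)" using le[OF l0] by simp
      obtain i where i: "i \<in> Ns ! 0" using block_nonempty l0 by fastforce
      have "i \<in> S" if "S \<in> ?W" for S
      proof -
        have "Suc 0 \<le> length Ns" using l0 by (rule Suc_leI)
        then have "sum_list (take (Suc 0) m) \<le> card (S \<inter> upper Ns (Suc 0))"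
          using that unfolding mem_vector_game by blast
        then have "card (Ns ! 0) \<le> card (S \<inter> Ns ! 0)"
          using eq l0 len by (simp add: sum_list_take_Suc upper_Suc)
        then have "S \<inter> Ns ! 0 = Ns ! 0"
          using finite_block[OF l0] by (intro card_seteq) auto
        then show ?thesis using i by blast
      qed
      then have "veto_player N ?W i" using i block_subset[OF l0] by (auto simp: veto_player_def)
      then show False using nt i block_subset[OF l0] by (auto simp: nontrivial_game_def)
    qed
    moreover have "0 < m ! ?l"
    proof (rule ccontr)
      assume "\<not> ?thesis"
      then have eq: "m ! ?l = 0" by simp
      obtain i where i: "i \<in> Ns ! ?l" using block_nonempty ll by fastforce
      then have iN: "i \<in> N" using block_subset[OF ll] by auto
      have "i \<notin> S" if S: "minimal_winning ?W S" for S
      proof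
        assume iS: "i \<in> S"
        have SW: "S \<in> ?W" using S by (simp add: minimal_winning_def)
        then have ge: "sum_list (take k m) \<le> card (S \<inter> upper Ns k)" if "k \<le> length Ns" for k
          using that by (auto simp: mem_vector_game)
        \<comment> \<open>Removing a player of the last class changes only the count of the full
          prefix, and with last entry \<open>0\<close> that prefix demands no more than the one
          before it.\<close>
        have low: "sum_list (take k m) \<le> card ((S - {i}) \<inter> upper Ns k)" if k: "k \<le> ?l" for k
        proof -
          have "i \<notin> upper Ns k" using mem_upper[OF ll i, of k] k ll by auto
          then have "(S - {i}) \<inter> upper Ns k = S \<inter> upper Ns k" by auto
          then show ?thesis using ge[of k] k by simp
        qed
        have "sum_list (take k m) \<le> card ((S - {i}) \<inter> upper Ns k)" if k: "k \<le> length Ns" for k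
        proof (cases "k \<le> ?l")
          case False
          then have k: "k = Suc ?l" using k ll by simp
          have "sum_list (take k m) = sum_list (take ?l m)"
            using eq len ll unfolding k by (simp only: sum_list_take_Suc)
          also have "\<dots> \<le> card ((S - {i}) \<inter> upper Ns ?l)" using low by simp
          also have "\<dots> \<le> card ((S - {i}) \<inter> upper Ns k)"
            unfolding k card_inter_upper_Suc[OF ll] by simp
          finally show ?thesis .
        qed (rule low)
        then have "S - {i} \<in> ?W" using SW by (auto simp: mem_vector_game)
        moreover have "S - {i} \<subset> S" using iS by auto
        ultimately show False using S by (auto simp: minimal_winning_def)
      qed
      then have "null_player N ?W i" using iN by (auto simp: null_player_def)
      then show False using nt iN by (auto simp: nontrivial_game_def)
    qed
    ultimately show "m ! 0 < map card Ns ! 0 \<and> 0 < m ! (length m - 1)" using l0 len by simp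
  next
    assume "m ! 0 < map card Ns ! 0 \<and> 0 < m ! (length m - 1)"
    then have hd: "m ! 0 < card (Ns ! 0)" and last: "0 < m ! ?l" using l0 len by auto
    have lt: "m ! h < card (Ns ! h)" if "h < length Ns" for h
      using hd step[of "h - 1"] that by (cases h) auto
    have pos: "0 < m ! h" if "h < length Ns" for h
    proof (cases "Suc h < length Ns")
      case False
      then have "h = ?l" using that by simp
      then show ?thesis using last by simp
    qed (use step in blast)
    have "\<not> veto_player N ?W i \<and> \<not> null_player N ?W i" if i: "i \<in> N" for i
    proof
      have "m ! h \<le> card (Ns ! h - {i})" if "h < length Ns" for h
        using lt[OF that] by (auto simp: card_Diff_singleton_if)
      then obtain T where T: "T \<subseteq> N" "T \<inter> {i} = {}" "profile Ns T = m"
        using coalition_with_profile[of m "{}" "{i}"] len by auto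
      then show "\<not> veto_player N ?W i"
        using profile_in_vector_game by (fastforce simp: veto_player_def)
      have "card ({i} \<inter> Ns ! h) \<le> m ! h" if "h < length Ns" for h
        using pos[OF that] card_mono[of "{i}" "{i} \<inter> Ns ! h"] by auto
      then obtain T where T: "T \<subseteq> N" "{i} \<subseteq> T" "profile Ns T = m"
        using coalition_with_profile[of m "{i}" "{}"] len i le by auto
      \<comment> \<open>A coalition of profile \<open>m\<close> has exactly the number of members
        that the full prefix demands, so it is a minimal winning coalition.\<close>
      have "T' \<notin> ?W" if "T' \<subset> T" for T'
      proof
        assume "T' \<in> ?W"
        then have "sum_list (take (length Ns) m) \<le> card (T' \<inter> upper Ns (length Ns))"
          unfolding mem_vector_game by blast
        then have "card T \<le> card (T' \<inter> N)"
          using card_inter_upper_profile[OF T(3), of "length Ns"] T(1) by (simp add: Int_absorb2)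
        moreover have "T' \<inter> N \<subset> T" using that by auto
        then have "card (T' \<inter> N) < card T"
          using T(1) finite_players by (intro psubset_card_mono) (auto intro: finite_subset)
        ultimately show False by simp
      qed
      then have "minimal_winning ?W T"
        using profile_in_vector_game[OF T(1,3)] by (auto simp: minimal_winning_def)
      then show "\<not> null_player N ?W i" using T(2) by (auto simp: null_player_def)
    qed
    then show "nontrivial_game N ?W" by (simp add: nontrivial_game_def)
  qed
qed

end

subsection \<open>Isomorphism\<close>

lemma (in ordered_partition) distinct_blocks: "distinct Ns"
  unfolding distinct_conv_nth using block_disjoint block_nonempty
  by (metis Int_absorb nth_mem)

lemma (in ordered_partition) sum_list_card_blocks: "sum_list (map card Ns) = card N"
proof -
  have "profile Ns N = map card Ns"
    using block_subset by (intro nth_equalityI) (auto simp: Int_absorb1)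
  then show ?thesis using sum_take_profile[of "length Ns" N] by simp
qed

lemma ordered_partition_with_sizes:
  assumes "finite N" "card N = sum_list ns" "\<forall>a\<in>set ns. 0 < a"
  shows "\<exists>Ns. ordered_partition N Ns \<and> map card Ns = ns"
  using assms
proof (induction ns arbitrary: N)
  case Nil
  then have "ordered_partition N []" by unfold_locales auto
  then show ?case by auto
next
  case (Cons a ns)
  obtain A where A: "A \<subseteq> N" "card A = a" "finite A"
    using obtain_subset_with_card_n[of a N] Cons.prems by auto
  have "card (N - A) = sum_list ns" using A Cons.prems by (simp add: card_Diff_subset)
  then obtain Ns where "ordered_partition (N - A) Ns" and Ns: "map card Ns = ns"
    using Cons.IH[of "N - A"] Cons.prems by auto
  then interpret ordered_partition "N - A" Ns by simp
  have "A \<noteq> {}" using A Cons.prems by auto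
  have "ordered_partition N (A # Ns)"
  proof
    show "finite N" by fact
    show "\<Union> (set (A # Ns)) = N" using Union_blocks A by auto
    show "B \<noteq> {}" if "B \<in> set (A # Ns)" for B using that \<open>A \<noteq> {}\<close> block_nonempty by auto
    show "(A # Ns) ! b \<inter> (A # Ns) ! c = {}"
      if "b < length (A # Ns)" "c < length (A # Ns)" "b \<noteq> c" for b c
      using that block_disjoint[of "b - 1" "c - 1"] block_subset[of "b - 1"] block_subset[of "c - 1"]
      by (cases b; cases c) auto
  qed
  then show ?case using Ns A by (intro exI[of _ "A # Ns"]) simp
qed

lemma (in ordered_partition) ordered_partition_image:
  assumes f: "bij_betw f N N"
  shows "ordered_partition N (map ((`) f) Ns)"
    and "map card (map ((`) f) Ns) = map card Ns"
    and "S \<subseteq> N \<Longrightarrow> profile (map ((`) f) Ns) (f ` S) = profile Ns S"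
proof -
  have inj: "inj_on f N" and img: "f ` N = N" using f by (auto simp: bij_betw_def)
  show "ordered_partition N (map ((`) f) Ns)"
  proof
    show "finite N" by (rule finite_players)
    show "\<Union> (set (map ((`) f) Ns)) = N"
      using img Union_blocks by (metis image_Union set_map)
    show "A \<noteq> {}" if "A \<in> set (map ((`) f) Ns)" for A using that block_nonempty by auto
    show "map ((`) f) Ns ! a \<inter> map ((`) f) Ns ! b = {}"
      if "a < length (map ((`) f) Ns)" "b < length (map ((`) f) Ns)" "a \<noteq> b" for a b
      using that inj_on_image_Int[OF inj block_subset block_subset, of a b] block_disjoint[of a b]
      by simp
  qed
  show "map card (map ((`) f) Ns) = map card Ns"
    using block_subset inj by (intro nth_equalityI) (auto intro!: card_image inj_on_subset[OF inj])
  show "profile (map ((`) f) Ns) (f ` S) = profile Ns S" if "S \<subseteq> N"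
  proof (rule nth_equalityI)
    fix h assume "h < length (profile (map ((`) f) Ns) (f ` S))"
    then have h: "h < length Ns" by simp
    have "f ` S \<inter> f ` (Ns ! h) = f ` (S \<inter> Ns ! h)"
      using inj_on_image_Int[OF inj that block_subset[OF h]] by simp
    moreover have "card (f ` (S \<inter> Ns ! h)) = card (S \<inter> Ns ! h)"
      using that by (intro card_image inj_on_subset[OF inj]) auto
    ultimately show "profile (map ((`) f) Ns) (f ` S) ! h = profile Ns S ! h" using h by simp
  qed simp
qed

lemma block_bijection:
  assumes "ordered_partition N Ns" "ordered_partition N Ns'" "map card Ns = map card Ns'"
  obtains f where "bij_betw f N N" "map ((`) f) Ns = Ns'"
proof -
  interpret A: ordered_partition N Ns by fact
  interpret B: ordered_partition N Ns' by fact
  have len: "length Ns = length Ns'" using assms(3) map_eq_imp_length_eq by blast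
  have "\<exists>g. bij_betw g (Ns ! h) (Ns' ! h)" if "h < length Ns" for h
    using that len A.finite_block B.finite_block assms(3)
    by (metis finite_same_card_bij nth_map)
  then obtain g where g: "\<And>h. h < length Ns \<Longrightarrow> bij_betw (g h) (Ns ! h) (Ns' ! h)" by metis
  define f where "f i = g (THE h. h < length Ns \<and> i \<in> Ns ! h) i" for i
  have f: "f i = g h i" if "h < length Ns" "i \<in> Ns ! h" for h i
  proof -
    have "(THE h. h < length Ns \<and> i \<in> Ns ! h) = h"
      using that A.block_unique by (intro the_equality) blast+
    then show ?thesis by (simp add: f_def)
  qed
  have img: "f ` (Ns ! h) = Ns' ! h" if "h < length Ns" for h
    using f[OF that] g[OF that] by (auto simp: bij_betw_def)
  then have map: "map ((`) f) Ns = Ns'" using len by (intro nth_equalityI) auto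
  have "f ` N = N"
    using A.Union_blocks B.Union_blocks map by (metis image_Union set_map)
  moreover have "inj_on f N"
  proof (rule inj_onI)
    fix i j assume ij: "i \<in> N" "j \<in> N" "f i = f j"
    then obtain a b where ab: "a < length Ns" "i \<in> Ns ! a" "b < length Ns" "j \<in> Ns ! b"
      using A.block_mem by blast
    then have "f i \<in> Ns' ! a" "f i \<in> Ns' ! b" using img ij(3) by blast+
    then have "a = b" using B.block_unique ab len by simp
    then show "i = j" using f ab ij(3) g[OF ab(1)] by (auto simp: bij_betw_def dest: inj_onD)
  qed
  ultimately show ?thesis using that map by (auto simp: bij_betw_def)
qed

section \<open>Class sizes and vector as a complete invariant\<close>

definition encodes :: "'a set \<Rightarrow> 'a set set \<Rightarrow> nat list \<times> nat list \<Rightarrow> bool" where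
  "encodes N W p \<longleftrightarrow> (\<exists>Ns. class_chain N W Ns \<and> fst p = map card Ns \<and>
     snd p \<in> game_vectors N W \<and> W = vector_game N Ns (snd p))"

lemma equiv_game_iso: "equiv {W. simple_game N W} (game_iso N)"
proof (rule equivI)
  show "game_iso N \<subseteq> {W. simple_game N W} \<times> {W. simple_game N W}"
    by (auto simp: game_iso_def)
  show "refl_on {W. simple_game N W} (game_iso N)"
    by (auto simp: refl_on_def game_iso_def intro!: exI[of _ id])
  show "sym (game_iso N)"
  proof (rule symI)
    fix W W' assume "(W, W') \<in> game_iso N"
    then obtain f where f: "bij_betw f N N" "\<And>S. S \<subseteq> N \<Longrightarrow> S \<in> W \<longleftrightarrow> f ` S \<in> W'"
      and game: "simple_game N W" "simple_game N W'" by (auto simp: game_iso_def)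
    define g where "g = inv_into N f"
    have g: "bij_betw g N N" unfolding g_def by (rule bij_betw_inv_into[OF f(1)])
    have "S \<in> W' \<longleftrightarrow> g ` S \<in> W" if "S \<subseteq> N" for S
    proof -
      have "g ` S \<subseteq> N" using g that by (auto simp: bij_betw_def)
      moreover have "f ` g ` S = S"
        unfolding g_def using f(1) that by (metis bij_betw_imp_surj_on image_inv_into_cancel)
      ultimately show ?thesis using f(2) by metis
    qed
    then show "(W', W) \<in> game_iso N" using g game by (auto simp: game_iso_def)
  qed
  show "trans (game_iso N)"
  proof (rule transI)
    fix W1 W2 W3 assume "(W1, W2) \<in> game_iso N" "(W2, W3) \<in> game_iso N"
    then obtain f g where f: "bij_betw f N N" "\<And>S. S \<subseteq> N \<Longrightarrow> S \<in> W1 \<longleftrightarrow> f ` S \<in> W2"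
      and g: "bij_betw g N N" "\<And>S. S \<subseteq> N \<Longrightarrow> S \<in> W2 \<longleftrightarrow> g ` S \<in> W3"
      and game: "simple_game N W1" "simple_game N W3"
      by (auto simp: game_iso_def)
    have "S \<in> W1 \<longleftrightarrow> (g \<circ> f) ` S \<in> W3" if "S \<subseteq> N" for S
    proof -
      have "f ` S \<subseteq> N" using f(1) that by (auto simp: bij_betw_def)
      then show ?thesis using f(2)[OF that] g(2) by (simp add: image_comp)
    qed
    then show "(W1, W3) \<in> game_iso N"
      using bij_betw_trans[OF f(1) g(1)] game by (auto simp: game_iso_def)
  qed
qed

text \<open>An isomorphism carries the blocks of \<open>W\<close> to a class chain of
  \<open>W'\<close>; chains and shift-minimal vectors being unique, both components agree.
  Conversely, equal block sizes give a bijection that maps block to block and hence preserves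
  profiles.\<close>

lemma encodes_game_iso:
  assumes fin: "finite N" and W: "simple_game N W" and W': "simple_game N W'"
    and p: "encodes N W p" and p': "encodes N W' p'"
  shows "(W, W') \<in> game_iso N \<longleftrightarrow> p = p'"
proof -
  obtain Ns where chain: "class_chain N W Ns" and ns: "fst p = map card Ns"
    and gv: "snd p \<in> game_vectors N W" and vg: "W = vector_game N Ns (snd p)"
    using p unfolding encodes_def by blast
  obtain Ns' where chain': "class_chain N W' Ns'" and ns': "fst p' = map card Ns'"
    and gv': "snd p' \<in> game_vectors N W'" and vg': "W' = vector_game N Ns' (snd p')"
    using p' unfolding encodes_def by blast
  interpret A: ordered_partition N Ns by (rule class_chain_partition[OF chain fin])
  interpret B: ordered_partition N Ns' by (rule class_chain_partition[OF chain' fin])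
  show ?thesis
  proof
    assume "(W, W') \<in> game_iso N"
    then obtain f where f: "bij_betw f N N" "\<And>S. S \<subseteq> N \<Longrightarrow> S \<in> W \<longleftrightarrow> f ` S \<in> W'"
      by (auto simp: game_iso_def)
    let ?M = "map ((`) f) Ns"
    interpret M: ordered_partition N ?M by (rule A.ordered_partition_image[OF f(1)])
    have card: "map card ?M = map card Ns" by (rule A.ordered_partition_image[OF f(1)])
    have "S \<in> W' \<longleftrightarrow> S \<in> vector_game N ?M (snd p)" for S
    proof (cases "S \<subseteq> N")
      case True
      then obtain R where R: "R \<subseteq> N" "S = f ` R"
        using f(1) by (metis bij_betw_imp_surj_on subset_imageE)
      have "S \<in> W' \<longleftrightarrow> dominates (profile Ns R) (snd p)"
        using f(2)[OF R(1)] R by (simp add: vg vector_game_def)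
      then show ?thesis
        using A.ordered_partition_image(3)[OF f(1) R(1)] R(2) True by (simp add: vector_game_def)
    next
      case False
      then show ?thesis using W' by (auto simp: vector_game_def simple_game_def)
    qed
    then have W'_eq: "W' = vector_game N ?M (snd p)" by auto
    have "admissible (map card ?M) (snd p)"
      unfolding card by (rule vector_game_admissible[OF chain fin W vg gv])
    \<comment> \<open>Rather than transporting desirability along \<open>f\<close>, the image blocks
      are recognised as the classes of \<open>W'\<close> through admissibility, which depends on the
      block sizes only.\<close>
    then have "class_chain N W' ?M" unfolding W'_eq by (rule M.admissible_vector_game)
    then have M: "?M = Ns'" using class_chain_unique chain' by blast
    have fst: "fst p = fst p'" using ns ns' card M by simp
    have "snd p \<in> game_vectors N W'"
    proof -
      have "length Ns = length Ns'" using M by auto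
      moreover have "card (Ns ! h) = card (Ns' ! h)" if "h < length Ns" for h
        using card M that by (metis nth_map length_map)
      ultimately show ?thesis using gv
        unfolding game_vectors_eq[OF chain] game_vectors_eq[OF chain'] by simp
    qed
    then have "{m. shift_minimal_winning N W' m} = {snd p}"
      using shift_minimal_vector_game[OF chain' fin W'] W'_eq M by simp
    moreover have "{m. shift_minimal_winning N W' m} = {snd p'}"
      using shift_minimal_vector_game[OF chain' fin W' vg' gv'] .
    ultimately show "p = p'" using fst by (simp add: prod_eq_iff)
  next
    assume eq: "p = p'"
    then obtain f where f: "bij_betw f N N" "map ((`) f) Ns = Ns'"
      using block_bijection[OF A.ordered_partition_axioms B.ordered_partition_axioms] ns ns' by auto
    have "S \<in> W \<longleftrightarrow> f ` S \<in> W'" if "S \<subseteq> N" for S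
    proof -
      have "f ` S \<subseteq> N" using f(1) that by (auto simp: bij_betw_def)
      then show ?thesis
        unfolding vg vg' using A.ordered_partition_image(3)[OF f(1) that] f(2) that eq
        by (simp add: vector_game_def)
    qed
    then show "(W, W') \<in> game_iso N" using f W W' by (auto simp: game_iso_def)
  qed
qed

text \<open>One element chosen for each code meets every class exactly once. The abstract form
  serves all games and the nontrivial ones alike.\<close>

lemma card_quotient_eq:
  assumes r: "equiv X r" and A: "A \<subseteq> X"
    and total: "\<And>W. W \<in> A \<Longrightarrow> \<exists>p\<in>P. R W p"
    and onto: "\<And>p. p \<in> P \<Longrightarrow> \<exists>W\<in>A. R W p"
    and iff: "\<And>W W' p p'. W \<in> A \<Longrightarrow> W' \<in> A \<Longrightarrow> R W p \<Longrightarrow> R W' p' \<Longrightarrow> (W, W') \<in> r \<longleftrightarrow> p = p'"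
  shows "card (A // r) = card P"
proof -
  obtain g where g: "\<And>p. p \<in> P \<Longrightarrow> g p \<in> A \<and> R (g p) p" using onto by metis
  have "inj_on (\<lambda>p. r `` {g p}) P"
  proof (rule inj_onI)
    fix p p' assume p: "p \<in> P" "p' \<in> P" "r `` {g p} = r `` {g p'}"
    then have "(g p, g p') \<in> r" using g A eq_equiv_class[OF _ r] by blast
    then show "p = p'" using iff g p by blast
  qed
  moreover have "(\<lambda>p. r `` {g p}) ` P = A // r"
  proof
    show "(\<lambda>p. r `` {g p}) ` P \<subseteq> A // r" using g by (auto simp: quotient_def)
    show "A // r \<subseteq> (\<lambda>p. r `` {g p}) ` P"
    proof
      fix C assume "C \<in> A // r"
      then obtain W where W: "W \<in> A" "C = r `` {W}" by (auto simp: quotient_def)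
      then obtain p where p: "p \<in> P" "R W p" using total by blast
      then have "(W, g p) \<in> r" using iff W g by blast
      then have "C = r `` {g p}" using W equiv_class_eq[OF r] by blast
      then show "C \<in> (\<lambda>p. r `` {g p}) ` P" using p by blast
    qed
  qed
  ultimately show ?thesis using card_image by metis
qed

definition game_params :: "nat \<Rightarrow> nat \<Rightarrow> (nat list \<times> nat list) set" where
  "game_params n t = {(ns, m). length ns = t \<and> sum_list ns = n \<and> admissible ns m \<and> tame ns m}"

subsection \<open>Counting\<close>

text \<open>\<open>F\<close> is indexed by the number of players, so the inner pair uses the
  \<open>n - a\<close> players left over by the new class.\<close>

definition add_veto :: "(nat \<Rightarrow> (nat list \<times> nat list) set) \<Rightarrow> nat \<Rightarrow> (nat list \<times> nat list) set" where
  "add_veto F n = {(a # ns, a # m) | a ns m. 0 < a \<and> a \<le> n \<and> (ns, m) \<in> F (n - a)}"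

definition add_null :: "(nat \<Rightarrow> (nat list \<times> nat list) set) \<Rightarrow> nat \<Rightarrow> (nat list \<times> nat list) set" where
  "add_null F n = {(ns @ [a], m @ [0]) | a ns m. 0 < a \<and> a \<le> n \<and> (ns, m) \<in> F (n - a)}"

definition core1 :: "nat \<Rightarrow> (nat list \<times> nat list) set" where
  "core1 n = {([n], [c]) | c. 0 < c \<and> c < n}"

definition core2 :: "nat \<Rightarrow> (nat list \<times> nat list) set" where
  "core2 n = {([a, b], [c, d]) | a b c d.
     a + b = n \<and> 0 < c \<and> c < a \<and> 0 < d \<and> d < b \<and> (d = 1 \<or> Suc d = b)}"

text \<open>This is the code of the game won only by the grand coalition. It has no core class, and
  joined by null players it is the case in which the first class is veto and the second
  null.\<close>

definition all_veto :: "nat \<Rightarrow> (nat list \<times> nat list) set" where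
  "all_veto n = {([a], [a]) | a. a = n \<and> 0 < a}"

text \<open>Bounded quantifiers let the simplifier run through all index choices once the lists have
  a concrete length.\<close>

lemma tame_bounded:
  "tame ns m \<longleftrightarrow>
     (\<forall>c<length ns. \<forall>b<c. \<forall>a<b. \<not> (core ns m a \<and> core ns m b \<and> core ns m c)) \<and>
     (\<forall>b<length ns. \<forall>a<b. core ns m a \<and> core ns m b \<longrightarrow> m ! b = 1 \<or> Suc (m ! b) = ns ! b)"
proof -
  have "core ns m h \<Longrightarrow> h < length ns" for h by (simp add: core_def)
  then show ?thesis unfolding tame_def by blast
qed

lemma params_singleton:
  "admissible [a] [c] \<and> tame [a] [c] \<longleftrightarrow> 0 < c \<and> c \<le> a"
  by (auto simp: admissible_def tame_bounded)

lemma params_pair: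
  "admissible [a, b] [c, d] \<and> tame [a, b] [c, d] \<longleftrightarrow>
     0 < c \<and> c \<le> a \<and> d < b \<and> (c = a \<or> d = 0 \<or> d = 1 \<or> Suc d = b)"
  by (auto simp: admissible_def tame_bounded All_less_Suc core_def)

lemma admissible_quadruple:
  "admissible [a1, a2, a3, a4] [c1, c2, c3, c4] \<longleftrightarrow>
     0 < c1 \<and> c1 \<le> a1 \<and> 0 < c2 \<and> c2 < a2 \<and> 0 < c3 \<and> c3 < a3 \<and> c4 < a4"
  by (auto simp: admissible_def All_less_Suc numeral_eq_Suc)

lemma admissible_triple:
  "admissible [a1, a2, a3] [c1, c2, c3] \<longleftrightarrow>
     0 < c1 \<and> c1 \<le> a1 \<and> 0 < c2 \<and> c2 < a2 \<and> c3 < a3"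
  by (auto simp: admissible_def All_less_Suc numeral_eq_Suc)

lemma params_triple:
  "admissible [a1, a2, a3] [c1, c2, c3] \<and> tame [a1, a2, a3] [c1, c2, c3] \<longleftrightarrow>
     0 < c1 \<and> c1 \<le> a1 \<and> 0 < c2 \<and> c2 < a2 \<and> c3 < a3 \<and>
     (c1 = a1 \<and> (c3 = 0 \<or> c3 = 1 \<or> Suc c3 = a3) \<or> c3 = 0 \<and> (c2 = 1 \<or> Suc c2 = a2))"
  unfolding admissible_triple
  by (simp add: tame_bounded All_less_Suc core_def numeral_eq_Suc) linarith

lemma params_quadruple:
  "admissible [a1, a2, a3, a4] [c1, c2, c3, c4] \<and> tame [a1, a2, a3, a4] [c1, c2, c3, c4] \<longleftrightarrow>
     0 < c1 \<and> c1 = a1 \<and> 0 < c2 \<and> c2 < a2 \<and> 0 < c3 \<and> c3 < a3 \<and> c4 = 0 \<and> 0 < a4 \<and>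
     (c3 = 1 \<or> Suc c3 = a3)"
  unfolding admissible_quadruple
  by (simp add: tame_bounded All_less_Suc core_def numeral_eq_Suc cong: conj_cong) linarith

text \<open>The classes at positions 1, 2 and 3 are neither first nor last, so admissibility puts
  all three into the core.\<close>

lemma game_params_ge_5:
  assumes "5 \<le> t"
  shows "game_params n t = {}"
proof -
  have False if "admissible ns m" "tame ns m" "length ns = t" for ns m
  proof -
    have "core ns m (Suc h)" if "h < 3" for h
      using \<open>admissible ns m\<close> \<open>length ns = t\<close> assms that by (auto simp: admissible_def core_def)
    then have "core ns m 1" "core ns m 2" "core ns m 3" by (auto simp: numeral_eq_Suc)
    moreover have "(1::nat) < 2" "(2::nat) < 3" by auto
    ultimately show False using \<open>tame ns m\<close> unfolding tame_def by blast
  qed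
  then show ?thesis by (auto simp: game_params_def)
qed

lemma length_4_conv: "length xs = 4 \<longleftrightarrow> (\<exists>a b c d. xs = [a, b, c, d])"
  by (auto simp: numeral_eq_Suc length_Suc_conv)

lemma length_3_conv: "length xs = 3 \<longleftrightarrow> (\<exists>a b c. xs = [a, b, c])"
  by (auto simp: numeral_eq_Suc length_Suc_conv)

lemma length_2_conv: "length xs = 2 \<longleftrightarrow> (\<exists>a b. xs = [a, b])"
  by (auto simp: numeral_eq_Suc length_Suc_conv)

lemma length_1_conv: "length xs = Suc 0 \<longleftrightarrow> (\<exists>a. xs = [a])"
  by (auto simp: length_Suc_conv)

lemma game_params_eq:
  "game_params n t =
     {(ns, m). length ns = t \<and> length m = t \<and> sum_list ns = n \<and> admissible ns m \<and> tame ns m}"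
  by (auto simp: game_params_def admissible_def)

lemma game_params_1: "game_params n 1 = core1 n \<union> all_veto n"
proof -
  have "game_params n 1 = {([n], [c]) | c. admissible [n] [c] \<and> tame [n] [c]}"
    by (auto simp: game_params_eq length_1_conv)
  then show ?thesis unfolding params_singleton by (auto simp: core1_def all_veto_def)
qed

lemma game_params_2:
  "game_params n 2 = (core2 n \<union> add_veto core1 n) \<union> (add_null core1 n \<union> add_null all_veto n)"
proof -
  have "game_params n 2 = {([a, b], [c, d]) | a b c d.
      a + b = n \<and> admissible [a, b] [c, d] \<and> tame [a, b] [c, d]}"
    by (auto simp: game_params_eq length_2_conv)
  then show ?thesis unfolding params_pair
    by (auto simp: core1_def core2_def all_veto_def add_veto_def add_null_def)
qed

text \<open>The middle class always belongs to the core, so at most one outer class does. The three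
  sets record whether the first class is veto, the last is null, or both.\<close>

lemma game_params_3:
  "game_params n 3 = add_veto core2 n \<union> add_null core2 n \<union> add_veto (add_null core1) n"
proof -
  have "game_params n 3 = {([a1, a2, a3], [c1, c2, c3]) | a1 a2 a3 c1 c2 c3.
      a1 + a2 + a3 = n \<and> admissible [a1, a2, a3] [c1, c2, c3] \<and> tame [a1, a2, a3] [c1, c2, c3]}"
    by (auto simp: game_params_eq length_3_conv)
  then show ?thesis unfolding params_triple
    by (auto simp: core1_def core2_def add_veto_def add_null_def)
qed

lemma game_params_4: "game_params n 4 = add_veto (add_null core2) n"
proof -
  have "game_params n 4 = {([a1, a2, a3, a4], [c1, c2, c3, c4]) | a1 a2 a3 a4 c1 c2 c3 c4.
      a1 + a2 + a3 + a4 = n \<and> admissible [a1, a2, a3, a4] [c1, c2, c3, c4] \<and>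
      tame [a1, a2, a3, a4] [c1, c2, c3, c4]}"
    by (auto simp: game_params_eq length_4_conv)
  then show ?thesis unfolding params_quadruple
    by (auto simp: core2_def add_veto_def add_null_def)
qed

lemma card_add_veto:
  assumes "\<And>k. finite (F k)"
  shows "finite (add_veto F n)" "card (add_veto F n) = (\<Sum>k<n. card (F k))"
proof -
  \<comment> \<open>The index \<open>k\<close> is the number of players outside the new class, which
    turns the count into a sum over \<open>k < n\<close>.\<close>
  let ?f = "\<lambda>(k, ns, m). ((n - k) # ns, (n - k) # m)"
  have eq: "add_veto F n = ?f ` (SIGMA k:{..<n}. F k)"
  proof
    show "add_veto F n \<subseteq> ?f ` (SIGMA k:{..<n}. F k)"
    proof
      fix p assume "p \<in> add_veto F n"
      then obtain a ns m where "p = (a # ns, a # m)" "0 < a" "a \<le> n" "(ns, m) \<in> F (n - a)"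
        by (auto simp: add_veto_def)
      then show "p \<in> ?f ` (SIGMA k:{..<n}. F k)"
        by (intro image_eqI[of _ _ "(n - a, ns, m)"]) auto
    qed
    show "?f ` (SIGMA k:{..<n}. F k) \<subseteq> add_veto F n" by (auto simp: add_veto_def)
  qed
  show "finite (add_veto F n)" unfolding eq using assms by auto
  have "inj_on ?f (SIGMA k:{..<n}. F k)" by (auto simp: inj_on_def)
  then show "card (add_veto F n) = (\<Sum>k<n. card (F k))"
    unfolding eq using assms by (simp add: card_image)
qed

lemma card_add_null:
  assumes "\<And>k. finite (F k)"
  shows "finite (add_null F n)" "card (add_null F n) = (\<Sum>k<n. card (F k))"
proof -
  let ?f = "\<lambda>(k, ns, m). (ns @ [n - k], m @ [0])"
  have eq: "add_null F n = ?f ` (SIGMA k:{..<n}. F k)"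
  proof
    show "add_null F n \<subseteq> ?f ` (SIGMA k:{..<n}. F k)"
    proof
      fix p assume "p \<in> add_null F n"
      then obtain a ns m where "p = (ns @ [a], m @ [0])" "0 < a" "a \<le> n" "(ns, m) \<in> F (n - a)"
        by (auto simp: add_null_def)
      then show "p \<in> ?f ` (SIGMA k:{..<n}. F k)"
        by (intro image_eqI[of _ _ "(n - a, ns, m)"]) auto
    qed
    show "?f ` (SIGMA k:{..<n}. F k) \<subseteq> add_null F n" by (auto simp: add_null_def)
  qed
  show "finite (add_null F n)" unfolding eq using assms by auto
  have "inj_on ?f (SIGMA k:{..<n}. F k)" by (auto simp: inj_on_def)
  then show "card (add_null F n) = (\<Sum>k<n. card (F k))"
    unfolding eq using assms by (simp add: card_image)
qed

lemma card_core1: "finite (core1 n)" "card (core1 n) = n - 1"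
proof -
  have eq: "core1 n = (\<lambda>c. ([n], [c])) ` {1..<n}" by (auto simp: core1_def)
  show "finite (core1 n)" unfolding eq by simp
  show "card (core1 n) = n - 1" unfolding eq by (subst card_image) (auto simp: inj_on_def)
qed

lemma card_all_veto: "finite (all_veto n)" "card (all_veto n) = of_bool (0 < n)"
proof -
  have "all_veto n = (if 0 < n then {([n], [n])} else {})" by (auto simp: all_veto_def)
  then show "finite (all_veto n)" "card (all_veto n) = of_bool (0 < n)" by simp_all
qed

text \<open>A second class of size \<open>b\<close> leaves \<open>n - b - 1\<close> values for the
  first entry. For the second entry there are the values \<open>1\<close> and \<open>b - 1\<close>,
  which coincide for \<open>b = 2\<close>.\<close>

lemma card_core2: "finite (core2 n)" "card (core2 n) = (n - 3) ^ 2"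
proof -
  define D :: "nat \<Rightarrow> nat set" where "D b = {d. 0 < d \<and> d < b \<and> (d = 1 \<or> Suc d = b)}" for b
  have D: "D b = (if b < 2 then {} else {1, b - 1})" for b by (auto simp: D_def)
  have fin: "finite (D b)" for b by (simp add: D)
  have card_D: "card (D b) = (if b < 2 then 0 else if b = 2 then 1 else 2)" for b
    by (auto simp: D)
  let ?f = "\<lambda>(b, c, d). ([n - b, b], [c, d])" and ?S = "SIGMA b:{..<n}. {1..<n - b} \<times> D b"
  have eq: "core2 n = ?f ` ?S"
  proof
    show "core2 n \<subseteq> ?f ` ?S"
    proof
      fix p assume "p \<in> core2 n"
      then obtain a b c d where "p = ([a, b], [c, d])" "a + b = n" "0 < c" "c < a" "d \<in> D b"
        by (auto simp: core2_def D_def)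
      then show "p \<in> ?f ` ?S" by (intro image_eqI[of _ _ "(b, c, d)"]) auto
    qed
    show "?f ` ?S \<subseteq> core2 n" by (auto simp: core2_def D_def)
  qed
  show "finite (core2 n)" unfolding eq using fin by auto
  have "inj_on ?f ?S" by (auto simp: inj_on_def)
  then have "card (core2 n) = (\<Sum>b<n. (n - b - 1) * card (D b))"
    unfolding eq using fin by (simp add: card_image)
  also have "\<dots> = (n - 3) ^ 2"
  proof (induction n)
    case (Suc n)
    \<comment> \<open>One more player adds one value of \<open>c\<close> for every \<open>b\<close>,
      so the increment is the number of choices for \<open>d\<close> over all \<open>b\<close>: the
      difference of consecutive squares, where truncated subtraction covers
      \<open>n \<le> 2\<close>.\<close>
    have D_sum: "(\<Sum>b<n. card (D b)) = 2 * n - 5"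
      by (induction n) (auto simp: card_D)
    have "(\<Sum>b<Suc n. (Suc n - b - 1) * card (D b)) = (\<Sum>b<n. (n - b) * card (D b))" by simp
    also have "\<dots> = (\<Sum>b<n. (n - b - 1) * card (D b) + card (D b))"
    proof (rule sum.cong)
      fix b assume "b \<in> {..<n}"
      then have "n - b = Suc (n - b - 1)" by simp
      then show "(n - b) * card (D b) = (n - b - 1) * card (D b) + card (D b)"
        by (metis add.commute mult_Suc)
    qed simp
    also have "\<dots> = (n - 3) ^ 2 + (2 * n - 5)" by (simp only: sum.distrib Suc.IH D_sum)
    also have "\<dots> = (Suc n - 3) ^ 2"
    proof (cases "3 \<le> n")
      case True
      then obtain k where "n = k + 3" using le_Suc_ex by (metis add.commute)
      then show ?thesis by (simp add: power2_eq_square)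
    next
      case False
      then show ?thesis by (cases "n = 2") auto
    qed
    finally show ?case .
  qed simp
  finally show "card (core2 n) = (n - 3) ^ 2" .
qed

text \<open>Weights are written down for the games without a null class behind and a further class
  behind a veto class, namely the three basic families; every other code arises from these by adding
  veto or null players.\<close>

lemma game_params_vector_weighted:
  assumes "(ns, m) \<in> game_params n t"
  shows "vector_weighted ns m"
proof -
  let ?ok = "\<lambda>F. \<forall>n ns m. (ns, m) \<in> F n \<longrightarrow> vector_weighted ns m"
  have core1: "?ok core1" by (auto simp: core1_def intro: vector_weighted_singleton)
  have all_veto: "?ok all_veto" by (auto simp: all_veto_def intro: vector_weighted_singleton)
  have core2: "?ok core2"
    using vector_weighted_pair_one vector_weighted_pair_all_but_one by (auto simp: core2_def)
  have veto: "?ok (add_veto F)" if "?ok F" for F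
    using that by (auto simp: add_veto_def intro: vector_weighted_veto)
  have null: "?ok (add_null F)" if "?ok F" for F
    using that by (auto simp: add_null_def intro: vector_weighted_null)
  have "t \<noteq> 0" using assms by (auto simp: game_params_def admissible_def)
  then consider "t = 1" | "t = 2" | "t = 3" | "t = 4" | "5 \<le> t" by linarith
  then show ?thesis
  proof cases
    case 1
    show ?thesis using assms core1 all_veto unfolding 1 game_params_1 by blast
  next
    case 2
    show ?thesis
      using assms core2 veto[OF core1] null[OF core1] null[OF all_veto]
      unfolding 2 game_params_2 by blast
  next
    case 3
    show ?thesis
      using assms veto[OF core2] null[OF core2] veto[OF null[OF core1]]
      unfolding 3 game_params_3 by blast
  next
    case 4
    show ?thesis using assms veto[OF null[OF core2]] unfolding 4 game_params_4 by blast
  next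
    case 5
    then show ?thesis using assms by (simp add: game_params_ge_5)
  qed
qed

section \<open>Correspondence between games and numerical codes\<close>

lemma weighted_games_encodes:
  assumes "W \<in> weighted_games n t 1"
  shows "\<exists>p\<in>game_params n t. encodes {1..n} W p"
proof -
  let ?N = "{1..n}"
  have w: "weighted_game ?N W" and t: "card (?N // desir_equiv ?N W) = t"
    and r: "card {m. shift_minimal_winning ?N W m} = 1"
    using assms by (auto simp: weighted_games_def)
  have game: "simple_game ?N W" using w by (simp add: weighted_game_def)
  have fin: "finite ?N" by simp
  obtain Ns where chain: "class_chain ?N W Ns" using weighted_class_chain[OF w fin] .
  interpret ordered_partition ?N Ns by (rule class_chain_partition[OF chain fin])
  obtain m where m: "m \<in> game_vectors ?N W" "W = vector_game ?N Ns m"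
    using unique_shift_minimal_vector_game[OF chain fin game r] .
  have "length Ns = t"
    using t chain distinct_card[OF distinct_blocks] by (simp add: class_chain_def)
  moreover have "sum_list (map card Ns) = n" using sum_list_card_blocks by simp
  moreover have "admissible (map card Ns) m"
    by (rule vector_game_admissible[OF chain fin game m(2,1)])
  moreover have "tame (map card Ns) m"
    using m(1) w unfolding m(2) game_vectors_eq[OF chain[unfolded m(2)]]
    by (intro weighted_imp_tame) auto
  ultimately have "(map card Ns, m) \<in> game_params n t" by (simp add: game_params_def)
  moreover have "encodes ?N W (map card Ns, m)" using chain m by (auto simp: encodes_def)
  ultimately show ?thesis by blast
qed

lemma game_params_encodes:
  assumes "p \<in> game_params n t"
  shows "\<exists>W\<in>weighted_games n t 1. encodes {1..n} W p"
proof -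
  let ?N = "{1..n}"
  obtain ns m where p: "p = (ns, m)" "length ns = t" "sum_list ns = n" "admissible ns m"
    using assms by (auto simp: game_params_def)
  have "\<forall>a\<in>set ns. 0 < a" using p(4) by (auto simp: admissible_def in_set_conv_nth)
  then obtain Ns where "ordered_partition ?N Ns" and ns: "map card Ns = ns"
    using ordered_partition_with_sizes[of ?N ns] p(3) by auto
  then interpret ordered_partition ?N Ns by simp
  let ?W = "vector_game ?N Ns m"
  have adm: "admissible (map card Ns) m" using p ns by simp
  have chain: "class_chain ?N ?W Ns" and game: "simple_game ?N ?W"
    by (rule admissible_vector_game[OF adm])+
  have w: "weighted_game ?N ?W"
    using game_params_vector_weighted assms p(1) ns game by (intro vector_weighted_game) auto
  have gv: "m \<in> game_vectors ?N ?W"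
    using adm unfolding game_vectors_eq[OF chain] by (auto simp: admissible_def)
  have "{m. shift_minimal_winning ?N ?W m} = {m}"
    using shift_minimal_vector_game[OF chain _ game refl gv] by simp
  moreover have "card (?N // desir_equiv ?N ?W) = t"
    using chain distinct_card[OF distinct_blocks] ns p(2) by (auto simp: class_chain_def)
  ultimately have "?W \<in> weighted_games n t 1" using w by (simp add: weighted_games_def)
  moreover have "encodes ?N ?W p" using chain gv p(1) ns by (auto simp: encodes_def)
  ultimately show ?thesis by blast
qed

lemma encodes_nontrivial:
  assumes "simple_game N W" "finite N" "encodes N W p"
  shows "nontrivial_game N W \<longleftrightarrow>
    snd p ! 0 < fst p ! 0 \<and> 0 < snd p ! (length (snd p) - 1)"
proof -
  obtain Ns where chain: "class_chain N W Ns" and ns: "fst p = map card Ns"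
    and gv: "snd p \<in> game_vectors N W" and vg: "W = vector_game N Ns (snd p)"
    using assms(3) unfolding encodes_def by blast
  interpret ordered_partition N Ns by (rule class_chain_partition[OF chain assms(2)])
  show ?thesis
    using nontrivial_vector_game[OF vector_game_admissible[OF chain assms(2,1) vg gv]]
    unfolding vg[symmetric] ns .
qed

definition nontrivial_params :: "nat \<Rightarrow> nat \<Rightarrow> (nat list \<times> nat list) set" where
  "nontrivial_params n t =
     {p \<in> game_params n t. snd p ! 0 < fst p ! 0 \<and> 0 < snd p ! (length (snd p) - 1)}"

lemma simple_weighted_games: "W \<in> weighted_games n t r \<Longrightarrow> simple_game {1..n} W"
  by (simp add: weighted_games_def weighted_game_def)

lemma wg_eq_card_params: "wg n t 1 = card (game_params n t)"
  unfolding wg_def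
proof (rule card_quotient_eq[OF equiv_game_iso, where R = "encodes {1..n}"])
  show "weighted_games n t 1 \<subseteq> {W. simple_game {1..n} W}"
    using simple_weighted_games by blast
qed (use weighted_games_encodes game_params_encodes encodes_game_iso[of "{1..n}"]
    simple_weighted_games in blast)+

lemma wg_hat_eq_card_params: "wg_hat n t 1 = card (nontrivial_params n t)"
  unfolding wg_hat_def
proof (rule card_quotient_eq[OF equiv_game_iso])
  let ?A = "{W \<in> weighted_games n t 1. nontrivial_game {1..n} W}"
  have fin: "finite {1..n}" by simp
  show "?A \<subseteq> {W. simple_game {1..n} W}" using simple_weighted_games by blast
  show "\<exists>p\<in>nontrivial_params n t. encodes {1..n} W p" if "W \<in> ?A" for W
    using that weighted_games_encodes encodes_nontrivial[OF _ fin] simple_weighted_games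
    unfolding nontrivial_params_def by blast
  show "\<exists>W\<in>?A. encodes {1..n} W p" if "p \<in> nontrivial_params n t" for p
    using that game_params_encodes encodes_nontrivial[OF _ fin] simple_weighted_games
    unfolding nontrivial_params_def by blast
  show "(W, W') \<in> game_iso {1..n} \<longleftrightarrow> p = p'"
    if "W \<in> ?A" "W' \<in> ?A" "encodes {1..n} W p" "encodes {1..n} W' p'" for W W' p p'
    using that encodes_game_iso[OF fin] simple_weighted_games by blast
qed

lemma nontrivial_params_1: "nontrivial_params n 1 = core1 n"
  unfolding nontrivial_params_def game_params_1 by (auto simp: core1_def all_veto_def)

lemma nontrivial_params_2: "nontrivial_params n 2 = core2 n"
  unfolding nontrivial_params_def game_params_2
  by (auto simp: core1_def core2_def all_veto_def add_veto_def add_null_def)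

text \<open>Every code with at least three classes has a veto class in front or a null class at the
  end.\<close>

lemma nontrivial_params_ge_3:
  assumes "3 \<le> t"
  shows "nontrivial_params n t = {}"
proof -
  consider "t = 3" | "t = 4" | "5 \<le> t" using assms by linarith
  then show ?thesis
  proof cases
    case 1
    show ?thesis unfolding 1 nontrivial_params_def game_params_3
      by (auto simp: add_veto_def add_null_def nth_append)
  next
    case 2
    show ?thesis unfolding 2 nontrivial_params_def game_params_4
      by (auto simp: add_veto_def)
  next
    case 3
    then show ?thesis by (simp add: nontrivial_params_def game_params_ge_5)
  qed
qed

section \<open>Closed forms of the sums\<close>

lemma sum_diff_1: "1 \<le> n \<Longrightarrow> real (\<Sum>k<n. k - 1) = (real n - 1) * (real n - 2) / 2"
  by (induction n rule: nat_induct_at_least) (auto simp: field_simps of_nat_diff)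

lemma sum_sum_diff_1:
  "1 \<le> n \<Longrightarrow> real (\<Sum>k<n. \<Sum>j<k. j - 1) = (real n - 1) * (real n - 2) * (real n - 3) / 6"
proof (induction n rule: nat_induct_at_least)
  case (Suc n)
  have "real (\<Sum>k<Suc n. \<Sum>j<k. j - 1) =
      (real n - 1) * (real n - 2) * (real n - 3) / 6 + (real n - 1) * (real n - 2) / 2"
    unfolding sum.lessThan_Suc of_nat_add Suc.IH sum_diff_1[OF Suc.hyps] ..
  then show ?case by (simp add: field_simps)
qed simp

text \<open>The nonzero terms are the squares of \<open>1\<close> up to \<open>n - 4\<close>. The
  induction starts at \<open>3\<close> because below it truncation makes the sum \<open>0\<close>
  while the polynomial does not vanish.\<close>

lemma sum_squares_diff_3:
  "3 \<le> n \<Longrightarrow> real (\<Sum>k<n. (k - 3) ^ 2) = (real n - 4) * (real n - 3) * (2 * real n - 7) / 6"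
proof (induction n rule: nat_induct_at_least)
  case (Suc n)
  have "real (\<Sum>k<Suc n. (k - 3) ^ 2) =
      (real n - 4) * (real n - 3) * (2 * real n - 7) / 6 + (real n - 3) ^ 2"
    unfolding sum.lessThan_Suc of_nat_add Suc.IH using Suc.hyps by (simp add: of_nat_diff)
  then show ?case by (simp add: field_simps power2_eq_square)
qed (simp add: numeral_eq_Suc)

lemma sum_sum_squares_diff_3:
  "3 \<le> n \<Longrightarrow> real (\<Sum>k<n. \<Sum>j<k. (j - 3) ^ 2) =
     (real n ^ 4 - 16 * real n ^ 3 + 95 * real n ^ 2 - 248 * real n + 240) / 12"
proof (induction n rule: nat_induct_at_least)
  case (Suc n)
  have "real (\<Sum>k<Suc n. \<Sum>j<k. (j - 3) ^ 2) =
      (real n ^ 4 - 16 * real n ^ 3 + 95 * real n ^ 2 - 248 * real n + 240) / 12 +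
      (real n - 4) * (real n - 3) * (2 * real n - 7) / 6"
    unfolding sum.lessThan_Suc of_nat_add Suc.IH sum_squares_diff_3[OF Suc.hyps] ..
  then show ?case by (simp add: field_simps power2_eq_square power3_eq_cube power4_eq_xxxx)
qed (simp add: numeral_eq_Suc)

lemma sum_of_bool_pos: "(\<Sum>k<n. of_bool (0 < k)) = n - (1 :: nat)"
  by (induction n) auto

lemma card_game_params_1: "card (game_params n 1) = n"
proof -
  have "core1 n \<inter> all_veto n = {}" by (auto simp: core1_def all_veto_def)
  then show ?thesis
    unfolding game_params_1 by (simp add: card_Un_disjoint card_core1 card_all_veto)
qed

text \<open>The summands count two core classes, one core class joined by veto or by null players
  (hence the factor 2), and veto players together with null players.\<close>

lemma card_game_params_2:
  "card (game_params n 2) = (n - 3) ^ 2 + 2 * (\<Sum>k<n. k - 1) + (n - 1)"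
proof -
  let ?A = "core2 n" and ?B = "add_veto core1 n" and ?C = "add_null core1 n"
    and ?D = "add_null all_veto n"
  have disj: "?A \<inter> ?B = {}" "?C \<inter> ?D = {}" "(?A \<union> ?B) \<inter> (?C \<union> ?D) = {}"
    by (auto simp: core1_def core2_def all_veto_def add_veto_def add_null_def)
  have fin: "finite ?A" "finite ?B" "finite ?C" "finite ?D"
    by (simp_all add: card_core1 card_core2 card_all_veto card_add_veto card_add_null)
  have "card (game_params n 2) = (card ?A + card ?B) + (card ?C + card ?D)"
    unfolding game_params_2 using disj fin by (simp add: card_Un_disjoint)
  then show ?thesis
    by (simp add: card_core1 card_core2 card_all_veto card_add_veto card_add_null sum_of_bool_pos)
qed

lemma card_game_params_3:
  "card (game_params n 3) = 2 * (\<Sum>k<n. (k - 3) ^ 2) + (\<Sum>k<n. \<Sum>j<k. j - 1)"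
proof -
  let ?A = "add_veto core2 n" and ?B = "add_null core2 n" and ?C = "add_veto (add_null core1) n"
  have disj: "?A \<inter> ?B = {}" "(?A \<union> ?B) \<inter> ?C = {}"
    by (auto simp: core1_def core2_def add_veto_def add_null_def)
  have fin: "finite ?A" "finite ?B" "finite ?C"
    by (simp_all add: card_core1 card_core2 card_add_veto card_add_null)
  have "card (game_params n 3) = (card ?A + card ?B) + card ?C"
    unfolding game_params_3 using disj fin by (simp add: card_Un_disjoint)
  then show ?thesis by (simp add: card_core1 card_core2 card_add_veto card_add_null)
qed

lemma card_game_params_4: "card (game_params n 4) = (\<Sum>k<n. \<Sum>j<k. (j - 3) ^ 2)"
  unfolding game_params_4 by (simp add: card_core2 card_add_veto card_add_null)

theorem theorem3p3:
  fixes n :: nat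
  assumes "n \<ge> 1"
  shows "real (wg_hat n 1 1) = real n - 1
    \<and> (n \<le> 2 \<longrightarrow> wg_hat n 2 1 = 0)
    \<and> (n \<ge> 3 \<longrightarrow> real (wg_hat n 2 1) = real n ^ 2 - 6 * real n + 9)
    \<and> (\<forall>t\<ge>3. wg_hat n t 1 = 0)
    \<and> wg n 1 1 = n
    \<and> (n \<le> 2 \<longrightarrow> real (wg n 2 1) = real n - 1)
    \<and> (n \<ge> 3 \<longrightarrow> real (wg n 2 1) = 2 * (real n - 2) ^ 2 + 2)
    \<and> (n \<le> 3 \<longrightarrow> wg n 3 1 = 0)
    \<and> (n \<ge> 4 \<longrightarrow> real (wg n 3 1) =
          (5 * real n ^ 3 - 48 * real n ^ 2 + 157 * real n - 174) / 6)
    \<and> (n \<le> 5 \<longrightarrow> wg n 4 1 = 0)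
    \<and> (n \<ge> 6 \<longrightarrow> real (wg n 4 1) =
          (real n ^ 4 - 16 * real n ^ 3 + 95 * real n ^ 2 - 248 * real n + 240) / 12)
    \<and> (\<forall>t\<ge>5. wg n t 1 = 0)"
proof -
  have t2: "real (wg n 2 1) = 2 * (real n - 2) ^ 2 + 2" if "n \<ge> 3"
  proof -
    have "real (wg n 2 1) = real ((n - 3) ^ 2) + 2 * real (\<Sum>k<n. k - 1) + real (n - 1)"
      unfolding wg_eq_card_params card_game_params_2 by simp
    moreover have "real ((n - 3) ^ 2) = (real n - 3) ^ 2" "real (n - 1) = real n - 1"
      using that by (simp_all add: of_nat_diff)
    ultimately show ?thesis
      unfolding sum_diff_1[OF assms] by (simp add: power2_eq_square field_simps)
  qed
  have t3: "real (wg n 3 1) = (5 * real n ^ 3 - 48 * real n ^ 2 + 157 * real n - 174) / 6" if "n \<ge> 3"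
  proof -
    have "real (wg n 3 1) = 2 * real (\<Sum>k<n. (k - 3) ^ 2) + real (\<Sum>k<n. \<Sum>j<k. j - 1)"
      unfolding wg_eq_card_params card_game_params_3 by simp
    then show ?thesis
      unfolding sum_squares_diff_3[OF that] sum_sum_diff_1[OF assms]
      by (simp add: field_simps power2_eq_square power3_eq_cube)
  qed
  have t4: "real (wg n 4 1) =
      (real n ^ 4 - 16 * real n ^ 3 + 95 * real n ^ 2 - 248 * real n + 240) / 12" if "n \<ge> 3"
    unfolding wg_eq_card_params card_game_params_4 using sum_sum_squares_diff_3[OF that] .
  have t2_small: "real (wg n 2 1) = real n - 1" if "n \<le> 2"
  proof -
    \<comment> \<open>Here the truncated \<open>n - 3\<close> is \<open>0\<close>, unlike the real
      \<open>n - 3\<close> in the polynomial, so the values are computed directly.\<close>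
    have "n = 1 \<or> n = 2" using that assms by linarith
    then show ?thesis
      unfolding wg_eq_card_params card_game_params_2 by (auto simp: numeral_eq_Suc)
  qed
  have t3_small: "wg n 3 1 = 0" if "n \<le> 3"
  proof -
    have "n = 1 \<or> n = 2 \<or> n = 3" using that assms by linarith
    then show ?thesis
      unfolding wg_eq_card_params card_game_params_3 by (auto simp: numeral_eq_Suc)
  qed
  have t4_small: "wg n 4 1 = 0" if "n \<le> 5"
    unfolding wg_eq_card_params card_game_params_4 using that by auto
  have "real (wg_hat n 1 1) = real n - 1"
    unfolding wg_hat_eq_card_params nontrivial_params_1 card_core1 using assms by (simp add: of_nat_diff)
  moreover have "wg_hat n 2 1 = 0" if "n \<le> 2"
    unfolding wg_hat_eq_card_params nontrivial_params_2 card_core2 using that by simp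
  moreover have "real (wg_hat n 2 1) = real n ^ 2 - 6 * real n + 9" if "n \<ge> 3"
    unfolding wg_hat_eq_card_params nontrivial_params_2 card_core2 using that
    by (simp add: of_nat_diff) (simp add: power2_eq_square algebra_simps)
  moreover have "wg_hat n t 1 = 0" if "t \<ge> 3" for t
    unfolding wg_hat_eq_card_params nontrivial_params_ge_3[OF that] by simp
  moreover have "wg n 1 1 = n" unfolding wg_eq_card_params card_game_params_1 ..
  moreover have "wg n t 1 = 0" if "t \<ge> 5" for t
    unfolding wg_eq_card_params game_params_ge_5[OF that] by simp
  ultimately show ?thesis using t2 t3 t4 t2_small t3_small t4_small by simp
qed

end
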